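(* In the model described in the context, the conditional hit probability $\mathrm{P}^{\mathrm{hit,CS}}_{i}=\mathbb{P}(\mathrm{SINR}_i>\beta)$ of file $i$ under the closest selection is $$\mathrm{P}^{\mathrm{hit,CS}}_{i}=\sum_{k=1}^{M-1}\sum_{t=0}^{M-1-k}Q_{k+t,k}\,\frac{e^{-\lambda\pi D^2}(\lambda\pi D^2)^{k+t}p_i^k(1-p_i)^t}{k!\,t!}+\sum_{k=1}^{\infty}Q_{M,k}\,\frac{e^{-\lambda p_i\pi D^2}(\lambda p_i\pi D^2)^k}{k!}\left(1-\sum_{t=0}^{M-1-k}\frac{e^{-\lambda(1-p_i)\pi D^2}(\lambda(1-p_i)\pi D^2)^t}{t!}\right)$$ (empty sums are $0$), where, for $1\le l\le M$ and $k\ge 1$, $$Q_{l,k}=\int_0^{D+\|\mathbf{x}_o\|}\left(\sum_{m=0}^{M-l}\frac{\beta^m r^{\alpha_i m}}{P^m m!}(-1)^m\frac{\mathrm{d}^m}{\mathrm{d}s^m}\Bigl[e^{-s\sigma^2}\mathcal{L}_{\mathcal{I}_o}(s)\Bigr]\bigg|_{s=\beta r^{\alpha_i}/P}\right)h_k(r)\,\mathrm{d}r,$$ and $$h_k(r)=\begin{cases}\frac{2kr}{D^2}\left(1-\frac{r^2}{D^2}\right)^{k-1}, & 0\le r<D-\|\mathbf{x}_o\|,\\ \frac{k}{\pi D^2}\frac{\partial\mathcal{B}_{\|\mathbf{x}_o\|}(r)}{\partial r}\left(1-\frac{\mathcal{B}_{\|\mathbf{x}_o\|}(r)}{\pi D^2}\right)^{k-1},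 & D-\|\mathbf{x}_o\|\le r<D+\|\mathbf{x}_o\|,\\ 0,& r\ge D+\|\mathbf{x}_o\|.\end{cases}$$
   Context: Parameters: $\lambda,\lambda_p,D,P,\beta>0$, $\sigma^2\ge 0$, $d_g\ge0$, pathloss exponents $0<\alpha_i<\alpha_o$ (the subscript in $\alpha_i$ is a label, unrelated to the file index $i$), $M\ge1$ an integer, $0\le p_i\le 1$, and $\mathbf{x}_o\in\mathbb{R}^2$ with $\|\mathbf{x}_o\|\le D$. The user of interest is at the origin. The radio units (RUs) of the representative cloud form a homogeneous Poisson point process $\Phi_{\mathbf{x}_o}$ of intensity $\lambda$ on the disk of center $\mathbf{x}_o$ and radius $D$. Each RU independently caches file $i$ with probability $p_i$; $\Phi^i_{\mathbf{x}_o}$ is the set of RUs caching file $i$. $n(\cdot)$ is the number of elements, and the number of active RUs is $n(\mathcal{A}_{\mathbf{x}_o})=\min\{M,n(\Phi_{\mathbf{x}_o})\}$. Closest selection: the serving RU $\mathbf{z}$ is the point of $\Phi^i_{\mathbf{x}_o}$ closest to the origin, if $\Phi^i_{\mathbf{x}_o}\neq\emptyset$. Then $$\mathrm{SINR}_i=\frac{P g_{\mathbf{z}}\|\mathbf{z}\|^{-\alpha_i}}{\sigma^2+\mathcal{I}_o},$$ and if $\Phi^i_{\mathbf{x}_o}=\emptyset$ the event $\mathrm{SINR}_i>\beta$ does not occur. Given $n(\mathcal{A}_{\mathbf{x}_o})=l$, the gain $g_{\mathbf{z}}$ is independent of the locations and of $\mathcal{I}_o$ with $\mathbb{P}(g_{\mathbf{z}}>t)=\sum_{m=0}^{M-l}\frac{t^m}{m!}e^{-t}$,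 $t\ge0$. $\mathcal{I}_o$ is the out of cloud interference, independent of the representative cloud, with Laplace transform $\mathcal{L}_{\mathcal{I}_o}(s)=\mathbb{E}\{e^{-s\mathcal{I}_o}\}$: $$\mathcal{I}_o=\sum_{\mathbf{x}\in\Phi_p}\sum_{\mathbf{y}\in\mathcal{A}_{\mathbf{x}}}P f_{\mathbf{y}}\|\mathbf{y}\|^{-\alpha_o},$$ where $\Phi_p$ is a homogeneous Poisson point process on $\mathbb{R}^2$ of intensity $\lambda_p$; given $\Phi_p$, for each $\mathbf{x}\in\Phi_p$, $\Phi_{\mathbf{x}}$ is an independent homogeneous Poisson point process of intensity $\lambda$ on the disk of center $\mathbf{x}$ and radius $D$; $\mathcal{A}_{\mathbf{x}}$ consists of $\min\{M,n\}$ of the $n$ points of $\Phi_{\mathbf{x}}$ at distance more than $d_g$ from the origin, chosen uniformly at random; the $f_{\mathbf{y}}$ are i.i.d. unit-mean exponential, independent of the locations. Finally, $$\mathcal{B}_{x}(y)=D^2\cos^{-1}\!\left(\frac{D^2+x^2-y^2}{2xD}\right)+y^2\cos^{-1}\!\left(\frac{y^2+x^2-D^2}{2xy}\right)-\frac12\sqrt{\left[(y+x)^2-D^2\right]\left[D^2-(y-x)^2\right]}.$$ *)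

theory Defs
  imports "HOL-Probability.Probability"
begin

type_synonym loc = "real ^ 2"

section \<open>Random point configurations\<close>

text \<open>
  Configurations are locally finite subsets of the plane, with the sigma-algebra generated by the
  numbers of points in bounded Borel sets.  A point process is a random element of this space.
\<close>

definition config_space :: "loc set set" where
  "config_space = {S. \<forall>B. bounded B \<longrightarrow> finite (S \<inter> B)}"

definition config :: "loc set measure" where
  "config = sigma config_space
     {{S \<in> config_space. card (S \<inter> B) = n} | B n. B \<in> sets borel \<and> bounded B}"

text \<open>
  The homogeneous Poisson point process of intensity \<open>lam\<close> on the Borel set \<open>S\<close>.
  The Poisson weights are written out because \<open>poisson_pmf\<close> excludes the rate \<open>0\<close>.
\<close>

definition poisson_process ::
  "'w measure \<Rightarrow> real \<Rightarrow> loc set \<Rightarrow> ('w \<Rightarrow> loc set) \<Rightarrow> bool" where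
  "poisson_process \<Omega> lam S \<Phi> \<longleftrightarrow>
     \<Phi> \<in> measurable \<Omega> config \<and>
     (\<forall>\<omega>\<in>space \<Omega>. \<Phi> \<omega> \<subseteq> S) \<and>
     (\<forall>B n. B \<in> sets borel \<and> bounded B \<longrightarrow>
        measure \<Omega> {\<omega> \<in> space \<Omega>. card (\<Phi> \<omega> \<inter> B) = n} =
          (lam * measure lborel (B \<inter> S)) ^ n / fact n * exp (- (lam * measure lborel (B \<inter> S)))) \<and>
     (\<forall>(J :: nat set) B. finite J \<and> (\<forall>j\<in>J. B j \<in> sets borel \<and> bounded (B j)) \<and>
        disjoint_family_on B J \<longrightarrow>
        prob_space.indep_vars \<Omega> (\<lambda>_. count_space UNIV) (\<lambda>j \<omega>. card (\<Phi> \<omega> \<inter> B j)) J)"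

text \<open>
  Independence of two random elements with values in possibly different types
  (\<open>indep_var\<close> requires a common type).
\<close>

definition indep_elements ::
  "'w measure \<Rightarrow> 'a measure \<Rightarrow> ('w \<Rightarrow> 'a) \<Rightarrow> 'b measure \<Rightarrow> ('w \<Rightarrow> 'b) \<Rightarrow> bool" where
  "indep_elements \<Omega> S X T Y \<longleftrightarrow>
     X \<in> measurable \<Omega> S \<and> Y \<in> measurable \<Omega> T \<and>
     prob_space.indep_set \<Omega> {X -` A \<inter> space \<Omega> | A. A \<in> sets S} {Y -` B \<inter> space \<Omega> | B. B \<in> sets T}"


section \<open>The representative cloud\<close>

text \<open>Law of the subset of a finite set \<open>S\<close> that keeps each point independently with probability \<open>p\<close>.\<close>

definition random_subset :: "real \<Rightarrow> loc set \<Rightarrow> loc set pmf" where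
  "random_subset p S = map_pmf (\<lambda>c. {x \<in> S. c x}) (Pi_pmf S False (\<lambda>_. bernoulli_pmf p))"

text \<open>
  \<open>\<Phi>'\<close> is the set of points of the (finite) point process \<open>\<Phi>\<close> that cache the file:
  \<open>random_subset p (\<Phi> \<omega>)\<close> is the conditional law of \<open>\<Phi>'\<close> given \<open>\<Phi>\<close>.
\<close>

definition independent_caching ::
  "'w measure \<Rightarrow> real \<Rightarrow> ('w \<Rightarrow> loc set) \<Rightarrow> ('w \<Rightarrow> loc set) \<Rightarrow> bool" where
  "independent_caching \<Omega> p \<Phi> \<Phi>' \<longleftrightarrow>
     \<Phi>' \<in> measurable \<Omega> config \<and>
     (\<forall>\<omega>\<in>space \<Omega>. \<Phi>' \<omega> \<subseteq> \<Phi> \<omega>) \<and>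
     (\<forall>E\<in>sets config. \<forall>F\<in>sets config.
        measure \<Omega> {\<omega> \<in> space \<Omega>. \<Phi> \<omega> \<in> E \<and> \<Phi>' \<omega> \<in> F} =
          (LINT \<omega>|\<Omega>. indicator E (\<Phi> \<omega>) * measure_pmf.prob (random_subset p (\<Phi> \<omega>)) F))"

text \<open>
  The serving gain: conditionally on \<open>min M (card \<Phi>) = l\<close> it has the stated tail and is independent
  of the locations, of the caching decisions and of the interference \<open>I\<close>.
  Only outcomes with a serving unit (\<open>\<Phi>' \<noteq> {}\<close>) matter.
\<close>

definition serving_gain ::
  "'w measure \<Rightarrow> nat \<Rightarrow> ('w \<Rightarrow> loc set) \<Rightarrow> ('w \<Rightarrow> loc set) \<Rightarrow> ('w \<Rightarrow> ennreal) \<Rightarrow>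
   ('w \<Rightarrow> real) \<Rightarrow> bool" where
  "serving_gain \<Omega> M \<Phi> \<Phi>' I g \<longleftrightarrow>
     g \<in> borel_measurable \<Omega> \<and>
     (\<forall>l\<in>{1..M}. \<forall>t\<ge>0. \<forall>E\<in>sets (config \<Otimes>\<^sub>M config \<Otimes>\<^sub>M borel).
        measure \<Omega> {\<omega> \<in> space \<Omega>. min M (card (\<Phi> \<omega>)) = l \<and> \<Phi>' \<omega> \<noteq> {} \<and>
                      (\<Phi> \<omega>, \<Phi>' \<omega>, I \<omega>) \<in> E \<and> g \<omega> > t} =
          (\<Sum>m\<in>{0..M - l}. t ^ m / fact m * exp (- t)) *
          measure \<Omega> {\<omega> \<in> space \<Omega>. min M (card (\<Phi> \<omega>)) = l \<and> \<Phi>' \<omega> \<noteq> {} \<and>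
                      (\<Phi> \<omega>, \<Phi>' \<omega>, I \<omega>) \<in> E})"

definition closest_point :: "loc set \<Rightarrow> loc" where
  "closest_point S = arg_min_on norm S"

text \<open>
  The interference may be infinite with probability one (small \<open>\<alpha>\<^sub>o\<close>), so it and the SINR take
  values in \<open>ennreal\<close>; there \<open>x / \<infinity> = 0\<close>, and \<open>x / 0 = \<infinity>\<close> for \<open>x > 0\<close>.
\<close>

definition SINR ::
  "real \<Rightarrow> real \<Rightarrow> real \<Rightarrow> ('w \<Rightarrow> loc set) \<Rightarrow> ('w \<Rightarrow> real) \<Rightarrow> ('w \<Rightarrow> ennreal) \<Rightarrow> 'w \<Rightarrow> ennreal" where
  "SINR P \<alpha>\<^sub>i \<sigma>2 \<Phi>' g I \<omega> =
     ennreal (P * g \<omega> * norm (closest_point (\<Phi>' \<omega>)) powr (- \<alpha>\<^sub>i)) / (ennreal \<sigma>2 + I \<omega>)"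

definition hit_probability ::
  "'w measure \<Rightarrow> real \<Rightarrow> real \<Rightarrow> real \<Rightarrow> real \<Rightarrow> ('w \<Rightarrow> loc set) \<Rightarrow> ('w \<Rightarrow> real) \<Rightarrow>
   ('w \<Rightarrow> ennreal) \<Rightarrow> real" where
  "hit_probability \<Omega> P \<alpha>\<^sub>i \<sigma>2 \<beta> \<Phi>' g I =
     measure \<Omega> {\<omega> \<in> space \<Omega>. \<Phi>' \<omega> \<noteq> {} \<and> SINR P \<alpha>\<^sub>i \<sigma>2 \<Phi>' g I \<omega> > ennreal \<beta>}"


section \<open>The out of cloud interference\<close>

definition uniform_active :: "nat \<Rightarrow> real \<Rightarrow> loc set \<Rightarrow> loc set pmf" where
  "uniform_active M d\<^sub>g S = (let S' = {y \<in> S. norm y > d\<^sub>g} in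
     pmf_of_set {T. T \<subseteq> S' \<and> card T = min M (card S')})"

text \<open>
  \<open>X j\<close> enumerates the parent process; it is almost surely infinite, its intensity being positive.
  \<open>C j\<close> is the cloud of \<open>X j\<close> and \<open>A j\<close> the set of its active units.
  That, given the parents, the clouds are independent Poisson processes on the disks centred at
  the parents is expressed by recentring: the sets \<open>C j - X j\<close> are independent of the parents and
  i.i.d. Poisson on the disk centred at the origin.
  \<open>y j i\<close> for \<open>i < card (A j)\<close> is any measurable enumeration of \<open>A j\<close>, and \<open>f j i\<close> is the fading of
  \<open>y j i\<close>; the fading variables with \<open>i \<ge> card (A j)\<close> are not used.
\<close>

locale out_of_cloud = prob_space \<Omega> for \<Omega> :: "'w measure" +
  fixes lam\<^sub>p lam D d\<^sub>g :: real and M :: nat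
    and X :: "nat \<Rightarrow> 'w \<Rightarrow> loc"
    and C A :: "nat \<Rightarrow> 'w \<Rightarrow> loc set"
    and y :: "nat \<Rightarrow> nat \<Rightarrow> 'w \<Rightarrow> loc"
    and f :: "nat \<Rightarrow> nat \<Rightarrow> 'w \<Rightarrow> real"
  assumes parents_measurable: "X j \<in> borel_measurable \<Omega>"
    and parents_distinct: "\<omega> \<in> space \<Omega> \<Longrightarrow> inj (\<lambda>j. X j \<omega>)"
    and parents_poisson: "poisson_process \<Omega> lam\<^sub>p UNIV (\<lambda>\<omega>. range (\<lambda>j. X j \<omega>))"
    and clouds_measurable: "C j \<in> measurable \<Omega> config"
    and clouds_poisson: "poisson_process \<Omega> lam (cball 0 D) (\<lambda>\<omega>. (\<lambda>z. z - X j \<omega>) ` C j \<omega>)"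
    and clouds_indep: "indep_vars (\<lambda>_. config) (\<lambda>j \<omega>. (\<lambda>z. z - X j \<omega>) ` C j \<omega>) UNIV"
    and clouds_indep_parents:
      "indep_elements \<Omega> (\<Pi>\<^sub>M j\<in>UNIV. borel) (\<lambda>\<omega> j. X j \<omega>)
                        (\<Pi>\<^sub>M j\<in>UNIV. config) (\<lambda>\<omega> j. (\<lambda>z. z - X j \<omega>) ` C j \<omega>)"
    and active_measurable: "A j \<in> measurable \<Omega> config"
    and active_subset: "\<omega> \<in> space \<Omega> \<Longrightarrow> A j \<omega> \<subseteq> {z \<in> C j \<omega>. norm z > d\<^sub>g}"
    and active_uniform:
      "E \<in> sets (\<Pi>\<^sub>M j\<in>UNIV. borel) \<Longrightarrow> F \<in> sets (\<Pi>\<^sub>M j\<in>UNIV. config) \<Longrightarrow>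
       (\<And>j. j < n \<Longrightarrow> G j \<in> sets config) \<Longrightarrow>
       prob {\<omega> \<in> space \<Omega>. (\<lambda>j. X j \<omega>) \<in> E \<and> (\<lambda>j. C j \<omega>) \<in> F \<and> (\<forall>j<n. A j \<omega> \<in> G j)} =
         (LINT \<omega>|\<Omega>. indicator E (\<lambda>j. X j \<omega>) * indicator F (\<lambda>j. C j \<omega>) *
            (\<Prod>j<n. measure_pmf.prob (uniform_active M d\<^sub>g (C j \<omega>)) (G j)))"
    and active_enumeration:
      "\<omega> \<in> space \<Omega> \<Longrightarrow> bij_betw (\<lambda>i. y j i \<omega>) {..<card (A j \<omega>)} (A j \<omega>)"
    and fading_indep: "indep_vars (\<lambda>_. borel) (\<lambda>(j, i). f j i) UNIV"
    and fading_exponential: "distributed \<Omega> lborel (f j i) (exponential_density 1)"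
    and fading_indep_locations:
      "indep_elements \<Omega>
         ((\<Pi>\<^sub>M j\<in>UNIV. borel) \<Otimes>\<^sub>M (\<Pi>\<^sub>M j\<in>UNIV. config) \<Otimes>\<^sub>M (\<Pi>\<^sub>M j\<in>UNIV. config) \<Otimes>\<^sub>M
          (\<Pi>\<^sub>M ji\<in>UNIV. borel))
         (\<lambda>\<omega>. (\<lambda>j. X j \<omega>, \<lambda>j. C j \<omega>, \<lambda>j. A j \<omega>, \<lambda>(j, i). y j i \<omega>))
         (\<Pi>\<^sub>M ji\<in>UNIV. borel) (\<lambda>\<omega>. \<lambda>(j, i). f j i \<omega>)"

definition interference ::
  "real \<Rightarrow> real \<Rightarrow> (nat \<Rightarrow> 'w \<Rightarrow> loc set) \<Rightarrow> (nat \<Rightarrow> nat \<Rightarrow> 'w \<Rightarrow> loc) \<Rightarrow>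
   (nat \<Rightarrow> nat \<Rightarrow> 'w \<Rightarrow> real) \<Rightarrow> 'w \<Rightarrow> ennreal" where
  "interference P \<alpha>\<^sub>o A y f \<omega> =
     (\<Sum>j. \<Sum>i<card (A j \<omega>). ennreal (P * f j i \<omega> * norm (y j i \<omega>) powr (- \<alpha>\<^sub>o)))"

text \<open>
  With \<open>exp (- s * \<infinity>) = 0\<close>, as appropriate for \<open>s > 0\<close>; only such \<open>s\<close> matter below, up to the
  null set \<open>r = 0\<close> of the integration.
\<close>

definition laplace_transform :: "'w measure \<Rightarrow> ('w \<Rightarrow> ennreal) \<Rightarrow> real \<Rightarrow> real" where
  "laplace_transform \<Omega> I s =
     (LINT \<omega>|\<Omega>. (if I \<omega> = \<infinity> then 0 else exp (- s * enn2real (I \<omega>))))"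


section \<open>The quantities in the formula\<close>

text \<open>Here \<open>x\<close> stands for the distance of the cloud centre from the origin.\<close>

definition lens_area :: "real \<Rightarrow> real \<Rightarrow> real \<Rightarrow> real" where
  "lens_area D x y =
     D\<^sup>2 * arccos ((D\<^sup>2 + x\<^sup>2 - y\<^sup>2) / (2 * x * D)) +
     y\<^sup>2 * arccos ((y\<^sup>2 + x\<^sup>2 - D\<^sup>2) / (2 * x * y)) -
     1 / 2 * sqrt (((y + x)\<^sup>2 - D\<^sup>2) * (D\<^sup>2 - (y - x)\<^sup>2))"

definition distance_density :: "real \<Rightarrow> real \<Rightarrow> nat \<Rightarrow> real \<Rightarrow> real" where
  "distance_density D x k r =
     (if 0 \<le> r \<and> r < D - x then 2 * real k * r / D\<^sup>2 * (1 - r\<^sup>2 / D\<^sup>2) ^ (k - 1)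
      else if D - x \<le> r \<and> r < D + x then
        real k / (pi * D\<^sup>2) * deriv (lens_area D x) r *
          (1 - lens_area D x r / (pi * D\<^sup>2)) ^ (k - 1)
      else 0)"

definition Q ::
  "nat \<Rightarrow> real \<Rightarrow> real \<Rightarrow> real \<Rightarrow> real \<Rightarrow> (real \<Rightarrow> real) \<Rightarrow> real \<Rightarrow> real \<Rightarrow> nat \<Rightarrow> nat \<Rightarrow> real" where
  "Q M P \<beta> \<alpha>\<^sub>i \<sigma>2 L D x l k =
     (LINT r:{0..D + x}|lborel.
        (\<Sum>m\<in>{0..M - l}. \<beta> ^ m * r powr (\<alpha>\<^sub>i * real m) / (P ^ m * fact m) * (-1) ^ m *
           (deriv ^^ m) (\<lambda>s. exp (- s * \<sigma>2) * L s) (\<beta> * r powr \<alpha>\<^sub>i / P)) *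
        distance_density D x k r)"

end

theory Submission
  imports Defs
begin

text \<open>
  On the event that the cloud has \<open>n\<close> units, \<open>k\<close> of them caching the file, the SINR exceeds \<open>\<beta>\<close> iff
  the gain exceeds the threshold \<open>\<beta> r\<^sup>\<alpha> (\<sigma>2 + I) / P\<close>, where \<open>r\<close> is the distance of the closest caching
  unit.  The gain is Erlang distributed and independent of this threshold, so the conditional
  probability is the expectation of \<open>\<Sum>m\<le>M-l. (s Y)\<^sup>m exp (- s Y) / m!\<close> with \<open>Y = \<sigma>2 + I\<close> and
  \<open>s = \<beta> r\<^sup>\<alpha> / P\<close>; integrating out \<open>I\<close> turns \<open>Y\<^sup>m exp (- s Y)\<close> into the \<open>m\<close>-th derivative of the Laplace
  transform.  Counting points inside and outside a disk of radius \<open>r\<close> around the user shows that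
  the closest caching unit is farther than \<open>r\<close> with conditional probability \<open>(1 - F r / (pi D\<^sup>2))\<^sup>k\<close>,
  where \<open>F r\<close> is the area of the intersection of that disk with the cloud.  Beyond
  \<open>r = D - norm x\<^sub>o\<close> this intersection is the union of two circular segments with a common chord,
  whose total area is \<open>lens_area\<close>; hence the density of the distance is \<open>distance_density\<close>.
\<close>

section \<open>Counts and nearest points of configurations\<close>

text \<open>Conditional laws are never formed. Each conditional statement becomes an identity of
  finite measures restricted to the event that fixes both counts, and two such measures on the line
  agree once they agree on all rays \<open>{t<..}\<close>; this serves for the gain and for the
  distance alike. Integrals stay in \<open>ennreal\<close> as long as possible, so exchanging them
  needs no integrability. The density formula is the awkward point: \<open>lens_area\<close> divides
  by zero when the cloud is centred at the user, and at the ends of its range \<open>deriv\<close>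
  is not controlled. The proof therefore works with the overlap area as a measure, which makes sense
  for every \<open>r\<close>, is continuous, and has a derivative inside its range off one point;
  the formula is compared with it almost everywhere. Finally, sigma-additivity gives an ordered
  series over \<open>k\<close>, while the claim is an unordered \<open>infsum\<close>. Nonnegativity
  of \<open>Q\<close> bridges the two; the signs in its formula hide it, its meaning as an
  expectation shows it.\<close>

lemma space_config [simp]: "space config = config_space"
  unfolding config_def by (auto simp: space_measure_of_conv)

lemma sets_config_count:
  assumes "B \<in> sets borel" "bounded B"
  shows "{S \<in> config_space. card (S \<inter> B) = n} \<in> sets config"
  unfolding config_def using assms by (intro in_measure_of) auto

lemma measurable_config_count:
  assumes "B \<in> sets borel" "bounded B"
  shows "(\<lambda>S. card (S \<inter> B)) \<in> measurable config (count_space UNIV)"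
proof -
  have "(\<lambda>S. card (S \<inter> B)) -` {n} \<inter> space config \<in> sets config" for n
    using sets_config_count[OF assms, of n] by (simp add: vimage_def Int_def conj_commute)
  then show ?thesis by (subst measurable_count_space_eq2_countable) auto
qed

lemma config_space_finite_Int: "S \<in> config_space \<Longrightarrow> bounded B \<Longrightarrow> finite (S \<inter> B)"
  by (auto simp: config_space_def)

lemma finite_in_config_space: "finite S \<Longrightarrow> S \<in> config_space"
  by (auto simp: config_space_def)

text \<open>Only counts in bounded sets generate \<open>config\<close>, so the plane is exhausted by
  balls of integer radius; local finiteness makes a zero \<open>card\<close> mean emptiness and not
  infinity.\<close>

lemma sets_config_nonempty: "{S \<in> config_space. S \<noteq> {}} \<in> sets config"
proof -
  have "S \<noteq> {} \<longleftrightarrow> (\<exists>n. card (S \<inter> cball 0 (real n)) \<noteq> 0)" if "S \<in> config_space" for S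
  proof -
    have "\<exists>n. z \<in> cball 0 (real n)" for z :: loc
      using real_arch_simple[of "norm z"] by auto
    then have "S \<noteq> {} \<longleftrightarrow> (\<exists>n. S \<inter> cball 0 (real n) \<noteq> {})" by fast
    then show ?thesis using config_space_finite_Int[OF that bounded_cball] by simp
  qed
  then have "{S \<in> config_space. S \<noteq> {}} = {S \<in> space config. \<exists>n. card (S \<inter> cball 0 (real n)) \<noteq> 0}"
    by auto
  also have "\<dots> \<in> sets config"
    by (intro sets.sets_Collect_countable_Ex sets.sets_Collect_neg)
      (simp add: sets_config_count)
  finally show ?thesis .
qed

text \<open>\<open>S\<close> may be infinite, but any \<open>s\<close> in \<open>S\<close> confines
  the search to the finite set \<open>S \<inter> cball 0 (norm s)\<close>, whose minimiser also
  beats every point outside the ball. A minimiser thus exists, which is all that the choice operator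
  needs.\<close>

lemma closest_point_config:
  assumes S: "S \<in> config_space" "S \<noteq> {}"
  shows "closest_point S \<in> S" and "z \<in> S \<Longrightarrow> norm (closest_point S) \<le> norm z"
proof -
  obtain s where s: "s \<in> S" using S by auto
  let ?T = "S \<inter> cball 0 (norm s)"
  have T: "finite ?T" "?T \<noteq> {}" using config_space_finite_Int[OF S(1)] s by auto
  let ?t = "arg_min_on norm ?T"
  have t: "?t \<in> ?T" "\<And>z. z \<in> ?T \<Longrightarrow> norm ?t \<le> norm z"
    using arg_min_if_finite[OF T, of norm] by (auto simp: not_less)
  have "is_arg_min norm (\<lambda>z. z \<in> S) ?t"
    unfolding is_arg_min_def
  proof (intro conjI notI; (elim exE conjE)?)
    show "?t \<in> S" using t by auto
    fix z assume z: "z \<in> S" "norm z < norm ?t"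
    then have "z \<in> ?T" using t(1) by auto
    then show False using t(2)[of z] z by simp
  qed
  then have "is_arg_min norm (\<lambda>z. z \<in> S) (closest_point S)"
    unfolding closest_point_def arg_min_on_def arg_min_def by (rule someI)
  then show "closest_point S \<in> S" and "z \<in> S \<Longrightarrow> norm (closest_point S) \<le> norm z"
    by (auto simp: is_arg_min_def not_less)
qed

text \<open>Pins down the value at \<open>{}\<close>, where \<open>closest_point\<close> is an
  arbitrary choice; with \<open>0\<close> the empty configuration never counts as farther than some
  \<open>r \<ge> 0\<close>.\<close>

definition nearest_distance :: "loc set \<Rightarrow> real" where
  "nearest_distance S = (if S = {} then 0 else norm (closest_point S))"

lemma nearest_distance_nonneg: "0 \<le> nearest_distance S"
  by (simp add: nearest_distance_def)

text \<open>Turns the closest point, defined by choice, into a void event of a bounded set.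
  Measurability of the distance and its tail both come from this.\<close>

lemma nearest_distance_gt_iff:
  assumes "S \<in> config_space" "S \<noteq> {}"
  shows "r < nearest_distance S \<longleftrightarrow> card (S \<inter> cball 0 r) = 0"
proof -
  have "r < nearest_distance S \<longleftrightarrow> S \<inter> cball 0 r = {}"
    using closest_point_config[OF assms] assms(2)
    by (force simp: nearest_distance_def not_le)
  then show ?thesis using config_space_finite_Int[OF assms(1), of "cball 0 r"] by simp
qed

lemma measurable_nearest_distance: "nearest_distance \<in> borel_measurable config"
proof (rule borel_measurableI_greater)
  fix r :: real
  show "{S \<in> space config. r < nearest_distance S} \<in> sets config"
  proof (cases "r < 0")
    case True
    then have "{S \<in> space config. r < nearest_distance S} = space config"
      using nearest_distance_nonneg less_le_trans by blast
    then show ?thesis by (metis sets.top)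
  next
    case False
    then have "{S \<in> space config. r < nearest_distance S} =
      {S \<in> config_space. S \<noteq> {}} \<inter> {S \<in> config_space. card (S \<inter> cball 0 r) = 0}"
      using nearest_distance_gt_iff[of _ r] by (auto simp: nearest_distance_def)
    also have "\<dots> \<in> sets config"
      using sets_config_nonempty sets_config_count[of "cball 0 r" 0] by (intro sets.Int) auto
    finally show ?thesis .
  qed
qed

section \<open>Independent thinning of finite configurations and of the Poisson process\<close>

lemma random_subset_subset:
  assumes "finite S"
  shows "set_pmf (random_subset p S) \<subseteq> Pow S"
  by (auto simp: random_subset_def)


lemma pmf_random_subset:
  assumes S: "finite S" and p: "0 \<le> p" "p \<le> 1" and T: "T \<subseteq> S"
  shows "pmf (random_subset p S) T = p ^ card T * (1 - p) ^ (card S - card T)"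
proof -
  let ?M = "Pi_pmf S False (\<lambda>_. bernoulli_pmf p)"
  have "pmf (random_subset p S) T = measure_pmf.prob ?M ((\<lambda>c. {x \<in> S. c x}) -` {T})"
    by (simp add: random_subset_def pmf_map)
  also have "\<dots> = measure_pmf.prob ?M {\<lambda>x. x \<in> T}"
  \<comment> \<open>The preimage of \<open>{T}\<close> also contains functions that are true
    somewhere outside \<open>S\<close>; they have mass zero because \<open>Pi_pmf\<close> fixes the
    default \<open>False\<close> there.\<close>
  proof (rule measure_prob_cong_0)
    fix c assume c: "c \<in> (\<lambda>c. {x \<in> S. c x}) -` {T} - {\<lambda>x. x \<in> T}"
    have "\<exists>x. x \<notin> S \<and> c x \<noteq> False"
    proof (rule ccontr)
      assume "\<not> ?thesis"
      then have "c = (\<lambda>x. x \<in> T)" using c by auto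
      then show False using c by simp
    qed
    then show "pmf ?M c = 0" by (rule pmf_Pi_outside[OF S])
  next
    fix c assume "c \<in> {\<lambda>x. x \<in> T} - (\<lambda>c. {x \<in> S. c x}) -` {T}"
    then show "pmf ?M c = 0" using T by auto
  qed
  also have "\<dots> = (\<Prod>x\<in>S. pmf (bernoulli_pmf p) (x \<in> T))"
    using T by (subst measure_pmf_single, subst pmf_Pi'[OF S]) auto
  also have "\<dots> = (\<Prod>x\<in>T. pmf (bernoulli_pmf p) (x \<in> T)) * (\<Prod>x\<in>S - T. pmf (bernoulli_pmf p) (x \<in> T))"
    by (rule prod.subset_diff[OF T S, THEN trans]) simp
  also have "\<dots> = p ^ card T * (1 - p) ^ card (S - T)"
    using p by simp
  finally show ?thesis
    using card_Diff_subset[OF finite_subset[OF T S] T] by simp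
qed

text \<open>The \<open>k\<close> retained points are chosen among the \<open>card (S - B)\<close>
  points outside \<open>B\<close>, and each choice has the same mass. \<open>W\<close> expresses the
  total number as a count in a set, the form that \<open>config\<close> can measure.\<close>

lemma prob_random_subset_avoiding:
  fixes k :: nat and B :: "loc set"
  assumes S: "finite S" "S \<subseteq> W" and p: "0 \<le> p" "p \<le> 1"
  defines "F \<equiv> {T \<in> config_space. card (T \<inter> W) = k} \<inter> {T \<in> config_space. card (T \<inter> B) = 0}"
  shows "measure_pmf.prob (random_subset p S) F =
    real (card (S - B) choose k) * p ^ k * (1 - p) ^ (card S - k)"
proof -
  let ?G = "{T. T \<subseteq> S - B \<and> card T = k}"
  have "T \<in> F \<longleftrightarrow> T \<in> ?G" if "T \<subseteq> S" for T
  proof -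
    have "finite T" "T \<inter> W = T" using that S finite_subset by auto
    then show ?thesis
      using that by (auto simp: F_def finite_in_config_space)
  qed
  \<comment> \<open>\<open>F\<close> also contains sets that are not subsets of \<open>S\<close>, so
    it is compared with \<open>?G\<close> on the support only.\<close>
  then have F: "F \<inter> set_pmf (random_subset p S) = ?G \<inter> set_pmf (random_subset p S)"
    using random_subset_subset[OF S(1), of p] by auto
  have "measure_pmf.prob (random_subset p S) F =
      measure_pmf.prob (random_subset p S) (F \<inter> set_pmf (random_subset p S))"
    by (rule measure_Int_set_pmf[symmetric])
  also have "\<dots> = measure_pmf.prob (random_subset p S) ?G"
    unfolding F by (rule measure_Int_set_pmf)
  also have "\<dots> = (\<Sum>T\<in>?G. pmf (random_subset p S) T)"
    using S(1) by (intro measure_measure_pmf_finite) simp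
  also have "\<dots> = (\<Sum>T\<in>?G. p ^ k * (1 - p) ^ (card S - k))"
    by (intro sum.cong refl) (subst pmf_random_subset[OF S(1) p], auto)
  also have "\<dots> = real (card (S - B) choose k) * p ^ k * (1 - p) ^ (card S - k)"
    using n_subsets[of "S - B" k] S(1) by simp
  finally show ?thesis .
qed

text \<open>Here \<open>j\<close> points lie outside a test set and \<open>n - j\<close> inside,
  with means \<open>v\<close> and \<open>u\<close>. Cancelling \<open>j choose k\<close> against
  \<open>fact j\<close> frees \<open>v ^ k / fact k\<close>, and what remains is the binomial
  expansion of \<open>(u + v) ^ (n - k)\<close>.\<close>

lemma thinned_binomial_sum:
  fixes u v :: real
  assumes "k \<le> n"
  shows "(\<Sum>j\<le>n. real (j choose k) * (u ^ (n - j) / fact (n - j)) * (v ^ j / fact j)) =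
    v ^ k / fact k * ((u + v) ^ (n - k) / fact (n - k))"
proof -
  obtain d where n: "n = k + d" using assms le_Suc_ex by blast
  have "(\<Sum>j\<le>n. real (j choose k) * (u ^ (n - j) / fact (n - j)) * (v ^ j / fact j)) =
      (\<Sum>j\<in>{k..n}. real (j choose k) * (u ^ (n - j) / fact (n - j)) * (v ^ j / fact j))"
    by (rule sum.mono_neutral_right) (auto simp: binomial_eq_0)
  also have "\<dots> = (\<Sum>i\<in>{0..d}. real ((i + k) choose k) * (u ^ (n - (i + k)) / fact (n - (i + k))) * (v ^ (i + k) / fact (i + k)))"
    by (rule sum.reindex_bij_witness[of _ "\<lambda>i. i + k" "\<lambda>j. j - k"]) (auto simp: n)
  also have "\<dots> = (\<Sum>i\<in>{0..d}. v ^ k / fact k / fact d * (real (d choose i) * v ^ i * u ^ (d - i)))"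
  proof (intro sum.cong refl)
    fix i assume i: "i \<in> {0..d}"
    have "real ((i + k) choose k) / fact (i + k) = 1 / (fact k * fact i)"
      using binomial_fact[of k "i + k", where 'a=real] by simp
    then have 1: "real ((i + k) choose k) * (v ^ (i + k) / fact (i + k)) = v ^ (i + k) / (fact k * fact i)"
      by (simp add: field_simps)
    have 2: "u ^ (n - (i + k)) / fact (n - (i + k)) = u ^ (d - i) * (real (d choose i) * fact i / fact d)"
      using binomial_fact[of i d, where 'a=real] i by (simp add: n)
    have "real ((i + k) choose k) * (u ^ (n - (i + k)) / fact (n - (i + k))) * (v ^ (i + k) / fact (i + k)) =
        (u ^ (n - (i + k)) / fact (n - (i + k))) * (real ((i + k) choose k) * (v ^ (i + k) / fact (i + k)))"
      by simp
    also have "\<dots> = v ^ k / fact k / fact d * (real (d choose i) * v ^ i * u ^ (d - i))"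
      unfolding 1 2 by (simp add: power_add mult_ac)
    finally show "real ((i + k) choose k) * (u ^ (n - (i + k)) / fact (n - (i + k))) * (v ^ (i + k) / fact (i + k)) =
        v ^ k / fact k / fact d * (real (d choose i) * v ^ i * u ^ (d - i))" .
  qed
  also have "\<dots> = v ^ k / fact k / fact d * (v + u) ^ d"
    unfolding binomial_ring[of v u] sum_distrib_left atMost_atLeast0 by simp
  finally show ?thesis by (simp add: n add.commute)
qed


text \<open>For \<open>k \<le> n\<close>, the probability that a Poisson variable of mean
  \<open>\<mu>\<close> equals \<open>n\<close> and that exactly \<open>k\<close> of the
  \<open>n\<close> points survive thinning with probability \<open>p\<close>; the binomial
  coefficient has been cancelled against \<open>fact n\<close>.\<close>

definition count_weight :: "real \<Rightarrow> real \<Rightarrow> nat \<Rightarrow> nat \<Rightarrow> real" where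
  "count_weight \<mu> p n k = exp (- \<mu>) * \<mu> ^ n * p ^ k * (1 - p) ^ (n - k) / (fact k * fact (n - k))"

lemma poisson_process_config:
  assumes "poisson_process \<Omega> lam S \<Phi>"
  shows "\<Phi> \<in> measurable \<Omega> config"
    and "\<omega> \<in> space \<Omega> \<Longrightarrow> \<Phi> \<omega> \<in> config_space"
    and "\<omega> \<in> space \<Omega> \<Longrightarrow> \<Phi> \<omega> \<subseteq> S"
proof -
  show 1: "\<Phi> \<in> measurable \<Omega> config" using assms by (simp add: poisson_process_def)
  show "\<omega> \<in> space \<Omega> \<Longrightarrow> \<Phi> \<omega> \<in> config_space" using measurable_space[OF 1] by simp
  show "\<omega> \<in> space \<Omega> \<Longrightarrow> \<Phi> \<omega> \<subseteq> S" using assms by (simp add: poisson_process_def)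
qed

lemma poisson_process_two_counts:
  assumes "prob_space \<Omega>" and P: "poisson_process \<Omega> lam S \<Phi>"
    and B: "B\<^sub>1 \<in> sets borel" "bounded B\<^sub>1" "B\<^sub>2 \<in> sets borel" "bounded B\<^sub>2" "B\<^sub>1 \<inter> B\<^sub>2 = {}"
  shows "measure \<Omega> {\<omega> \<in> space \<Omega>. card (\<Phi> \<omega> \<inter> B\<^sub>1) = a \<and> card (\<Phi> \<omega> \<inter> B\<^sub>2) = b} =
    (lam * measure lborel (B\<^sub>1 \<inter> S)) ^ a / fact a * exp (- (lam * measure lborel (B\<^sub>1 \<inter> S))) *
    ((lam * measure lborel (B\<^sub>2 \<inter> S)) ^ b / fact b * exp (- (lam * measure lborel (B\<^sub>2 \<inter> S))))"
proof -
  interpret prob_space \<Omega> by fact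
  let ?J = "{0, 1 :: nat}"
  define B where "B j = (if j = 0 then B\<^sub>1 else B\<^sub>2)" for j :: nat
  define x where "x j = (if j = 0 then a else b)" for j :: nat
  have "finite ?J \<and> (\<forall>j\<in>?J. B j \<in> sets borel \<and> bounded (B j)) \<and> disjoint_family_on B ?J"
    using B by (auto simp: B_def disjoint_family_on_def)
  then have "indep_vars (\<lambda>_. count_space UNIV) (\<lambda>j \<omega>. card (\<Phi> \<omega> \<inter> B j)) ?J"
    using P unfolding poisson_process_def by blast
  then have "prob (\<Inter>j\<in>?J. (\<lambda>\<omega>. card (\<Phi> \<omega> \<inter> B j)) -` {x j} \<inter> space \<Omega>) =
      (\<Prod>j\<in>?J. prob ((\<lambda>\<omega>. card (\<Phi> \<omega> \<inter> B j)) -` {x j} \<inter> space \<Omega>))"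
    by (rule indep_varsD) auto
  moreover have "(\<Inter>j\<in>?J. (\<lambda>\<omega>. card (\<Phi> \<omega> \<inter> B j)) -` {x j} \<inter> space \<Omega>) =
      {\<omega> \<in> space \<Omega>. card (\<Phi> \<omega> \<inter> B\<^sub>1) = a \<and> card (\<Phi> \<omega> \<inter> B\<^sub>2) = b}"
    by (auto simp: B_def x_def)
  moreover have "prob ((\<lambda>\<omega>. card (\<Phi> \<omega> \<inter> B j)) -` {x j} \<inter> space \<Omega>) =
      (lam * measure lborel (B j \<inter> S)) ^ x j / fact (x j) * exp (- (lam * measure lborel (B j \<inter> S)))" for j
  proof -
    have "(\<lambda>\<omega>. card (\<Phi> \<omega> \<inter> B j)) -` {x j} \<inter> space \<Omega> = {\<omega> \<in> space \<Omega>. card (\<Phi> \<omega> \<inter> B j) = x j}"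
      by auto
    moreover have "B j \<in> sets borel" "bounded (B j)" using B by (auto simp: B_def)
    ultimately show ?thesis using P unfolding poisson_process_def by simp
  qed
  ultimately have "prob {\<omega> \<in> space \<Omega>. card (\<Phi> \<omega> \<inter> B\<^sub>1) = a \<and> card (\<Phi> \<omega> \<inter> B\<^sub>2) = b} =
      (\<Prod>j\<in>?J. (lam * measure lborel (B j \<inter> S)) ^ x j / fact (x j) * exp (- (lam * measure lborel (B j \<inter> S))))"
    by (simp only:)
  then show ?thesis by (simp add: B_def x_def)
qed

text \<open>Split by the number \<open>j\<close> of cloud points outside \<open>B\<close>: this
  number and the number inside are independent Poisson counts, and all caching units must lie among
  the \<open>j\<close>. Taking \<open>B = {}\<close> gives the joint law of the two counts, a ball
  about the user gives the tail of the nearest distance.\<close>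

lemma joint_law_counts:
  assumes ps: "prob_space \<Omega>" and P: "poisson_process \<Omega> lam (cball c D) \<Phi>"
    and caching: "independent_caching \<Omega> p \<Phi> \<Phi>'" and p: "0 \<le> p" "p \<le> 1" and D: "0 < D"
    and B: "B \<in> sets borel" "bounded B" and k: "k \<le> n"
  shows "measure \<Omega> {\<omega> \<in> space \<Omega>. card (\<Phi> \<omega>) = n \<and> card (\<Phi>' \<omega>) = k \<and> card (\<Phi>' \<omega> \<inter> B) = 0} =
    count_weight (lam * pi * D\<^sup>2) p n k * (1 - measure lborel (B \<inter> cball c D) / (pi * D\<^sup>2)) ^ k"
proof -
  interpret prob_space \<Omega> by fact
  note \<Phi> = poisson_process_config[OF P]
  let ?W = "cball c D"
  define u where "u = lam * measure lborel (B \<inter> ?W)"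
  define v where "v = lam * measure lborel ((?W - B) \<inter> ?W)"
  have area: "measure lborel ?W = pi * D\<^sup>2" using D by (simp add: measure_def emeasure_cball unit_ball_vol_2)
  have "measure lborel ((?W - B) \<inter> ?W) = measure lborel (?W - (B \<inter> ?W))"
    by (rule arg_cong[where f="measure lborel"]) auto
  also have "\<dots> = measure lborel ?W - measure lborel (B \<inter> ?W)"
    using B by (intro measurable_measure_Diff fmeasurableI emeasure_bounded_finite) auto
  finally have m: "measure lborel ((?W - B) \<inter> ?W) = measure lborel ?W - measure lborel (B \<inter> ?W)" .
  \<comment> \<open>The mean number outside \<open>B\<close> is the total mean times the uncovered
    fraction of the disk; its \<open>k\<close>-th power produces the last factor of the
    claim.\<close>
  have v: "v = lam * pi * D\<^sup>2 * (1 - measure lborel (B \<inter> ?W) / (pi * D\<^sup>2))"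
    unfolding v_def m area using D by (simp add: field_simps)
  have uv: "u + v = lam * pi * D\<^sup>2"
    unfolding u_def v using D by (simp add: field_simps)
  let ?E = "{S \<in> config_space. card (S \<inter> ?W) = n}"
  let ?F = "{T \<in> config_space. card (T \<inter> ?W) = k} \<inter> {T \<in> config_space. card (T \<inter> B) = 0}"
  have EF: "?E \<in> sets config" "?F \<in> sets config"
    using B by (auto intro!: sets_config_count sets.Int)
  have \<Phi>'_sub: "\<Phi>' \<omega> \<subseteq> \<Phi> \<omega>" "\<Phi>' \<omega> \<in> config_space" if "\<omega> \<in> space \<Omega>" for \<omega>
    using caching measurable_space[of \<Phi>' \<Omega> config] that by (auto simp: independent_caching_def)
  have Int_W: "\<Phi> \<omega> \<inter> ?W = \<Phi> \<omega>" "\<Phi>' \<omega> \<inter> ?W = \<Phi>' \<omega>" "finite (\<Phi> \<omega>)" if "\<omega> \<in> space \<Omega>" for \<omega>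
    using \<Phi>(3)[OF that] \<Phi>'_sub[OF that] config_space_finite_Int[OF \<Phi>(2)[OF that], of ?W]
    by (auto simp: Int_absorb2)
  \<comment> \<open>For \<open>j \<le> n\<close> the events \<open>K j\<close> partition the event
    that the cloud has \<open>n\<close> points.\<close>
  define K where "K j = {\<omega> \<in> space \<Omega>. card (\<Phi> \<omega> \<inter> B) = n - j \<and> card (\<Phi> \<omega> \<inter> (?W - B)) = j}" for j
  have cB: "(\<lambda>\<omega>. card (\<Phi> \<omega> \<inter> B')) \<in> measurable \<Omega> (count_space UNIV)" if "B' \<in> sets borel" "bounded B'" for B'
    using measurable_compose[OF \<Phi>(1) measurable_config_count[OF that]] .
  have K: "K j \<in> events" for j
  proof -
    have [measurable]: "(\<lambda>\<omega>. card (\<Phi> \<omega> \<inter> B)) \<in> measurable \<Omega> (count_space UNIV)"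
      "(\<lambda>\<omega>. card (\<Phi> \<omega> \<inter> (?W - B))) \<in> measurable \<Omega> (count_space UNIV)"
      using B by (auto intro!: cB bounded_diff)
    show ?thesis unfolding K_def by measurable
  qed
  have prob_K: "prob (K j) = u ^ (n - j) / fact (n - j) * exp (- u) * (v ^ j / fact j * exp (- v))" for j
    unfolding K_def u_def v_def using B
    by (intro poisson_process_two_counts[OF ps P]) (auto intro!: bounded_diff)
  have "{\<omega> \<in> space \<Omega>. card (\<Phi> \<omega>) = n \<and> card (\<Phi>' \<omega>) = k \<and> card (\<Phi>' \<omega> \<inter> B) = 0} =
      {\<omega> \<in> space \<Omega>. \<Phi> \<omega> \<in> ?E \<and> \<Phi>' \<omega> \<in> ?F}"
    using Int_W \<Phi>'_sub \<Phi>(2) by auto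
  with caching[unfolded independent_caching_def, THEN conjunct2, THEN conjunct2, rule_format, OF EF]
  have "measure \<Omega> {\<omega> \<in> space \<Omega>. card (\<Phi> \<omega>) = n \<and> card (\<Phi>' \<omega>) = k \<and> card (\<Phi>' \<omega> \<inter> B) = 0} =
      (\<integral>\<omega>. indicator ?E (\<Phi> \<omega>) * measure_pmf.prob (random_subset p (\<Phi> \<omega>)) ?F \<partial>\<Omega>)"
    by (simp only:)
  also have "\<dots> = (\<integral>\<omega>. (\<Sum>j\<le>n. indicator (K j) \<omega> * (real (j choose k) * p ^ k * (1 - p) ^ (n - k))) \<partial>\<Omega>)"
  proof (rule Bochner_Integration.integral_cong[OF refl])
    fix \<omega> assume \<omega>: "\<omega> \<in> space \<Omega>"
    let ?S = "\<Phi> \<omega>"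
    have fin: "finite ?S" and subW: "?S \<subseteq> ?W" and SC: "?S \<in> config_space" using Int_W \<omega> \<Phi> by auto
    have out: "?S \<inter> (?W - B) = ?S - B" using subW by auto
    have split: "card ?S = card (?S \<inter> B) + card (?S - B)"
      using card_Int_Diff[OF fin] .
    have rs: "measure_pmf.prob (random_subset p ?S) ?F = real (card (?S - B) choose k) * p ^ k * (1 - p) ^ (card ?S - k)"
      by (rule prob_random_subset_avoiding[OF fin subW p])
    show "indicator ?E ?S * measure_pmf.prob (random_subset p ?S) ?F =
      (\<Sum>j\<le>n. indicator (K j) \<omega> * (real (j choose k) * p ^ k * (1 - p) ^ (n - k)))"
    proof (cases "card ?S = n")
      case True
      have "(\<Sum>j\<le>n. indicator (K j) \<omega> * (real (j choose k) * p ^ k * (1 - p) ^ (n - k))) =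
          (\<Sum>j\<in>{card (?S - B)}. indicator (K j) \<omega> * (real (j choose k) * p ^ k * (1 - p) ^ (n - k)))"
        using True split by (intro sum.mono_neutral_right) (auto simp: K_def out)
      also have "\<dots> = real (card (?S - B) choose k) * p ^ k * (1 - p) ^ (n - k)"
        using True split \<omega> by (auto simp: K_def out)
      finally show ?thesis using True SC rs Int_W[OF \<omega>] by simp
    next
      case False
      then have "\<omega> \<notin> K j" if "j \<le> n" for j
        using split that by (auto simp: K_def out)
      then show ?thesis using False Int_W[OF \<omega>] by simp
    qed
  qed
  also have "\<dots> = (\<Sum>j\<le>n. prob (K j) * (real (j choose k) * p ^ k * (1 - p) ^ (n - k)))"
    using K by (subst Bochner_Integration.integral_sum) (auto simp: emeasure_eq_measure)
  also have "\<dots> = (\<Sum>j\<le>n. p ^ k * (1 - p) ^ (n - k) * exp (- (u + v)) *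
      (real (j choose k) * (u ^ (n - j) / fact (n - j)) * (v ^ j / fact j)))"
  proof -
    have "exp (- (u + v)) = exp (- u) * exp (- v)" by (simp flip: exp_add)
    then show ?thesis unfolding prob_K by (intro sum.cong refl) (simp add: mult_ac)
  qed
  also have "\<dots> = p ^ k * (1 - p) ^ (n - k) * exp (- (u + v)) *
      (v ^ k / fact k * ((u + v) ^ (n - k) / fact (n - k)))"
    unfolding sum_distrib_left[symmetric] thinned_binomial_sum[OF k] ..
  also have "\<dots> = count_weight (lam * pi * D\<^sup>2) p n k * (1 - measure lborel (B \<inter> ?W) / (pi * D\<^sup>2)) ^ k"
  proof -
    have "(lam * pi * D\<^sup>2) ^ n = (lam * pi * D\<^sup>2) ^ k * (lam * pi * D\<^sup>2) ^ (n - k)"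
      using k by (simp flip: power_add)
    then show ?thesis
      unfolding uv unfolding v power_mult_distrib[of "lam * pi * D\<^sup>2"] count_weight_def by simp
  qed
  finally show ?thesis .
qed

section \<open>Derivatives of the Laplace transform\<close>

text \<open>One term of the exponential series at \<open>c * y\<close> is at most the whole series.
  The bound is uniform in \<open>y\<close>, so no moments of the interference have to exist.\<close>

lemma power_times_exp_le:
  fixes y c :: real
  assumes "0 \<le> y" "0 < c"
  shows "y ^ m * exp (- c * y) \<le> fact m / c ^ m"
proof -
  have "(c * y) ^ m / fact m \<le> exp (c * y)"
    using sum_le_suminf[OF summable_exp_generic[of "c * y"], of "{m}"] assms
    by (simp add: exp_def divide_inverse mult.commute)
  then have "(c * y) ^ m * exp (- c * y) \<le> fact m"
    by (simp add: exp_minus field_simps)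
  then show ?thesis
    using assms by (simp add: field_simps power_mult_distrib)
qed

text \<open>This is \<open>1 - exp (- x) \<le> x\<close> after the larger exponential is factored
  out. A common lower bound \<open>c\<close> of the rates makes the estimate uniform over nearby
  rates.\<close>

lemma exp_neg_diff_le:
  fixes y a b c :: real
  assumes "0 \<le> y" "c \<le> a" "c \<le> b"
  shows "\<bar>exp (- a * y) - exp (- b * y)\<bar> \<le> \<bar>a - b\<bar> * (y * exp (- c * y))"
  using assms
proof (induction a b rule: linorder_wlog)
  case (le a b)
  have "exp (- a * y) - exp (- b * y) = exp (- a * y) * (1 - exp (- ((b - a) * y)))"
    by (simp add: algebra_simps flip: exp_add)
  also have "\<dots> \<le> exp (- c * y) * ((b - a) * y)"
  proof (rule mult_mono)
    show "exp (- a * y) \<le> exp (- c * y)" using le by (simp add: mult_right_mono)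
    show "1 - exp (- ((b - a) * y)) \<le> (b - a) * y"
      using exp_ge_add_one_self[of "- ((b - a) * y)"] by linarith
    show "0 \<le> 1 - exp (- ((b - a) * y))" using le by simp
  qed simp
  finally show ?case using le by (simp add: mult_ac mult_right_mono)
next
  case (sym a b)
  then show ?case by (simp add: abs_minus_commute)
qed

context prob_space
begin

lemma integrable_power_times_exp:
  fixes Y :: "'a \<Rightarrow> real"
  assumes [measurable]: "Y \<in> borel_measurable M" "B \<in> events"
    and Y: "\<And>\<omega>. \<omega> \<in> space M \<Longrightarrow> 0 \<le> Y \<omega>" and s: "0 < s"
  shows "integrable M (\<lambda>\<omega>. indicator B \<omega> * ((- Y \<omega>) ^ m * exp (- s * Y \<omega>)))"
proof (rule integrable_const_bound[where B="fact m / s ^ m"])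
  show "AE \<omega> in M. norm (indicator B \<omega> * ((- Y \<omega>) ^ m * exp (- s * Y \<omega>))) \<le> fact m / s ^ m"
    using power_times_exp_le[OF Y s, of _ m] s
    by (auto intro!: AE_I2 simp: indicator_def abs_mult power_abs[symmetric] Y)
qed measurable

text \<open>Differentiation under the integral by dominated convergence, a statement about
  sequences; hence the derivative is tested along arbitrary null sequences. The set \<open>B\<close>
  will be the event of finite interference.\<close>

lemma has_derivative_laplace_moment:
  fixes Y :: "'a \<Rightarrow> real"
  assumes [measurable]: "Y \<in> borel_measurable M" "B \<in> events"
    and Y: "\<And>\<omega>. \<omega> \<in> space M \<Longrightarrow> 0 \<le> Y \<omega>" and s: "0 < s"
  defines "F \<equiv> \<lambda>m s. \<integral>\<omega>. indicator B \<omega> * ((- Y \<omega>) ^ m * exp (- s * Y \<omega>)) \<partial>M"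
  shows "(F m has_real_derivative F (Suc m) s) (at s)"
proof -
  note integrable = integrable_power_times_exp[OF assms(1,2) Y]
  have "((\<lambda>h. (F m (s + h) - F m s) / h) \<longlongrightarrow> F (Suc m) s) (at 0)"
    unfolding tendsto_at_iff_sequentially
  proof (intro allI impI)
    fix X :: "nat \<Rightarrow> real" assume X: "\<forall>i. X i \<in> UNIV - {0}" "X \<longlonglongrightarrow> 0"
    \<comment> \<open>Dropping finitely many terms keeps all rates above \<open>s / 2\<close>, so
      that one constant dominates every difference quotient.\<close>
    from order_tendstoD[OF tendsto_rabs_zero[OF X(2)], of "s / 2"] s
    obtain N where N: "\<And>n. N \<le> n \<Longrightarrow> \<bar>X n\<bar> < s / 2"
      by (auto simp: eventually_sequentially)
    define Z where "Z n = X (n + N)" for n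
    have Z: "Z n \<noteq> 0" "\<bar>Z n\<bar> < s / 2" for n
      using X(1) N[of "n + N"] by (auto simp: Z_def)
    have Z0: "Z \<longlonglongrightarrow> 0" unfolding Z_def by (rule LIMSEQ_ignore_initial_segment[OF X(2)])
    let ?q = "\<lambda>h \<omega>. indicator B \<omega> * ((- Y \<omega>) ^ m * ((exp (- (s + h) * Y \<omega>) - exp (- s * Y \<omega>)) / h))"
    have "(\<lambda>n. \<integral>\<omega>. ?q (Z n) \<omega> \<partial>M) \<longlonglongrightarrow> F (Suc m) s"
      unfolding F_def
    proof (rule integral_dominated_convergence[where w="\<lambda>_. fact (Suc m) / (s / 2) ^ Suc m"])
      show "AE \<omega> in M. (\<lambda>n. ?q (Z n) \<omega>) \<longlonglongrightarrow> indicator B \<omega> * ((- Y \<omega>) ^ Suc m * exp (- s * Y \<omega>))"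
      proof (rule AE_I2)
        fix \<omega>
        have "((\<lambda>s. exp (- s * Y \<omega>)) has_real_derivative (- Y \<omega> * exp (- s * Y \<omega>))) (at s)"
          by (auto intro!: derivative_eq_intros)
        then have "((\<lambda>h. (exp (- (s + h) * Y \<omega>) - exp (- s * Y \<omega>)) / h) \<longlongrightarrow> - Y \<omega> * exp (- s * Y \<omega>)) (at 0)"
          by (simp only: DERIV_def)
        then have "(\<lambda>n. (exp (- (s + Z n) * Y \<omega>) - exp (- s * Y \<omega>)) / Z n) \<longlonglongrightarrow> - Y \<omega> * exp (- s * Y \<omega>)"
          by (rule filterlim_compose) (auto intro!: filterlim_atI Z0 simp: Z)
        then have "(\<lambda>n. ?q (Z n) \<omega>) \<longlonglongrightarrow> indicator B \<omega> * ((- Y \<omega>) ^ m * (- Y \<omega> * exp (- s * Y \<omega>)))"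
          by (intro tendsto_mult tendsto_const)
        then show "(\<lambda>n. ?q (Z n) \<omega>) \<longlonglongrightarrow> indicator B \<omega> * ((- Y \<omega>) ^ Suc m * exp (- s * Y \<omega>))"
          by (simp add: mult_ac)
      qed
      show "AE \<omega> in M. norm (?q (Z n) \<omega>) \<le> fact (Suc m) / (s / 2) ^ Suc m" for n
      proof (rule AE_I2)
        fix \<omega> assume \<omega>: "\<omega> \<in> space M"
        have "\<bar>exp (- (s + Z n) * Y \<omega>) - exp (- s * Y \<omega>)\<bar> \<le> \<bar>Z n\<bar> * (Y \<omega> * exp (- (s / 2) * Y \<omega>))"
          using exp_neg_diff_le[OF Y[OF \<omega>], of "s / 2" "s + Z n" s] Z(2)[of n] s
          by (simp add: abs_less_iff)
        then have "\<bar>exp (- (s + Z n) * Y \<omega>) - exp (- s * Y \<omega>)\<bar> / \<bar>Z n\<bar> \<le> Y \<omega> * exp (- (s / 2) * Y \<omega>)"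
          using Z(1)[of n] by (simp add: pos_divide_le_eq mult_ac)
        then have "Y \<omega> ^ m * (\<bar>exp (- (s + Z n) * Y \<omega>) - exp (- s * Y \<omega>)\<bar> / \<bar>Z n\<bar>) \<le>
            Y \<omega> ^ m * (Y \<omega> * exp (- (s / 2) * Y \<omega>))"
          using Y[OF \<omega>] by (intro mult_left_mono) auto
        also have "\<dots> \<le> fact (Suc m) / (s / 2) ^ Suc m"
          using power_times_exp_le[OF Y[OF \<omega>], of "s / 2" "Suc m"] s by (simp add: mult_ac)
        finally have *: "Y \<omega> ^ m * (\<bar>exp (- (s + Z n) * Y \<omega>) - exp (- s * Y \<omega>)\<bar> / \<bar>Z n\<bar>) \<le>
            fact (Suc m) / (s / 2) ^ Suc m" .
        have "norm (?q (Z n) \<omega>) =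
          indicator B \<omega> * (Y \<omega> ^ m * (\<bar>exp (- (s + Z n) * Y \<omega>) - exp (- s * Y \<omega>)\<bar> / \<bar>Z n\<bar>))"
          using Y[OF \<omega>] by (simp add: abs_mult power_abs)
        also have "\<dots> \<le> 1 * (Y \<omega> ^ m * (\<bar>exp (- (s + Z n) * Y \<omega>) - exp (- s * Y \<omega>)\<bar> / \<bar>Z n\<bar>))"
          using Y[OF \<omega>] by (intro mult_right_mono) auto
        finally show "norm (?q (Z n) \<omega>) \<le> fact (Suc m) / (s / 2) ^ Suc m"
          using * by linarith
      qed
    qed simp_all
    moreover have "(\<integral>\<omega>. ?q (Z n) \<omega> \<partial>M) = (F m (s + Z n) - F m s) / Z n" for n
    proof -
      have "0 < s + Z n" using Z(2)[of n] s by (simp add: abs_less_iff)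
      define d where "d \<omega> = indicator B \<omega> * ((- Y \<omega>) ^ m * exp (- (s + Z n) * Y \<omega>)) -
          indicator B \<omega> * ((- Y \<omega>) ^ m * exp (- s * Y \<omega>))" for \<omega>
      have "F m (s + Z n) - F m s = integral\<^sup>L M d"
        unfolding F_def d_def using \<open>0 < s + Z n\<close> s
        by (intro Bochner_Integration.integral_diff[symmetric] integrable)
      then have "(F m (s + Z n) - F m s) / Z n = (\<integral>\<omega>. d \<omega> / Z n \<partial>M)"
        by (simp only: integral_divide_zero)
      also have "(\<lambda>\<omega>. d \<omega> / Z n) = ?q (Z n)"
        by (simp only: d_def right_diff_distrib[symmetric] times_divide_eq_right)
      finally show ?thesis ..
    qed
    ultimately have "(\<lambda>n. (F m (s + Z n) - F m s) / Z n) \<longlonglongrightarrow> F (Suc m) s"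
      by (simp only:)
    then have "(\<lambda>n. (F m (s + X n) - F m s) / X n) \<longlonglongrightarrow> F (Suc m) s"
      unfolding Z_def by (rule LIMSEQ_offset)
    then show "((\<lambda>h. (F m (s + h) - F m s) / h) \<circ> X) \<longlonglongrightarrow> F (Suc m) s"
      by (simp add: o_def)
  qed
  then show ?thesis by (simp add: DERIV_def)
qed

lemma higher_deriv_laplace:
  fixes Y :: "'a \<Rightarrow> real"
  assumes Y: "Y \<in> borel_measurable M" "\<And>\<omega>. \<omega> \<in> space M \<Longrightarrow> 0 \<le> Y \<omega>" and B: "B \<in> events"
    and G: "\<And>s. 0 < s \<Longrightarrow> G s = (\<integral>\<omega>. indicator B \<omega> * exp (- s * Y \<omega>) \<partial>M)"
    and s: "0 < s"
  shows "(deriv ^^ m) G s = (\<integral>\<omega>. indicator B \<omega> * ((- Y \<omega>) ^ m * exp (- s * Y \<omega>)) \<partial>M)"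
  using s
proof (induction m arbitrary: s)
  case 0
  then show ?case by (simp add: G)
next
  case (Suc m)
  \<comment> \<open>The induction hypothesis holds for positive arguments only, but
    \<open>deriv\<close> sees just a neighbourhood, and the half-line \<open>{0<..}\<close> is
    open.\<close>
  have "eventually (\<lambda>t. (deriv ^^ m) G t =
      (\<integral>\<omega>. indicator B \<omega> * ((- Y \<omega>) ^ m * exp (- t * Y \<omega>)) \<partial>M)) (nhds s)"
    using Suc eventually_nhds_in_open[of "{0<..}" s] by (auto elim!: eventually_mono)
  then have "deriv ((deriv ^^ m) G) s =
      deriv (\<lambda>t. \<integral>\<omega>. indicator B \<omega> * ((- Y \<omega>) ^ m * exp (- t * Y \<omega>)) \<partial>M) s"
    by (rule deriv_cong_ev) simp
  also have "\<dots> = (\<integral>\<omega>. indicator B \<omega> * ((- Y \<omega>) ^ Suc m * exp (- s * Y \<omega>)) \<partial>M)"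
    by (rule DERIV_imp_deriv, rule has_derivative_laplace_moment[OF Y(1) B Y(2) Suc.prems])
  finally show ?case by simp
qed

end

section \<open>Independence and random thresholds\<close>

text \<open>By independence the joint law and the product of the laws agree on rectangles, hence
  everywhere; the rest is Tonelli.\<close>

lemma nn_integral_indep_elements:
  assumes "prob_space \<Omega>" and ind: "indep_elements \<Omega> S X T Y"
    and F: "F \<in> borel_measurable (S \<Otimes>\<^sub>M T)"
  shows "(\<integral>\<^sup>+\<omega>. F (X \<omega>, Y \<omega>) \<partial>\<Omega>) = (\<integral>\<^sup>+\<omega>. (\<integral>\<^sup>+\<omega>'. F (X \<omega>, Y \<omega>') \<partial>\<Omega>) \<partial>\<Omega>)"
proof -
  interpret prob_space \<Omega> by fact
  have X[measurable]: "X \<in> measurable \<Omega> S" and Y[measurable]: "Y \<in> measurable \<Omega> T"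
    and i: "indep_set {X -` A \<inter> space \<Omega> | A. A \<in> sets S} {Y -` B \<inter> space \<Omega> | B. B \<in> sets T}"
    using ind by (auto simp: indep_elements_def)
  interpret X: prob_space "distr \<Omega> S X" by (rule prob_space_distr[OF X])
  interpret Y: prob_space "distr \<Omega> T Y" by (rule prob_space_distr[OF Y])
  have eq: "distr \<Omega> S X \<Otimes>\<^sub>M distr \<Omega> T Y = distr \<Omega> (S \<Otimes>\<^sub>M T) (\<lambda>\<omega>. (X \<omega>, Y \<omega>))"
  proof (rule pair_measure_eqI)
    fix A B assume AB: "A \<in> sets (distr \<Omega> S X)" "B \<in> sets (distr \<Omega> T Y)"
    then have "prob ((X -` A \<inter> space \<Omega>) \<inter> (Y -` B \<inter> space \<Omega>)) = prob (X -` A \<inter> space \<Omega>) * prob (Y -` B \<inter> space \<Omega>)"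
      by (intro indep_setD[OF i]) auto
    moreover have "(\<lambda>\<omega>. (X \<omega>, Y \<omega>)) -` (A \<times> B) \<inter> space \<Omega> = (X -` A \<inter> space \<Omega>) \<inter> (Y -` B \<inter> space \<Omega>)"
      by auto
    ultimately show "emeasure (distr \<Omega> S X) A * emeasure (distr \<Omega> T Y) B =
        emeasure (distr \<Omega> (S \<Otimes>\<^sub>M T) (\<lambda>\<omega>. (X \<omega>, Y \<omega>))) (A \<times> B)"
      using AB by (simp add: emeasure_distr emeasure_eq_measure ennreal_mult'')
  qed (auto intro: X.sigma_finite_measure_axioms Y.sigma_finite_measure_axioms)
  have "(\<integral>\<^sup>+\<omega>. F (X \<omega>, Y \<omega>) \<partial>\<Omega>) = (\<integral>\<^sup>+z. F z \<partial>distr \<Omega> (S \<Otimes>\<^sub>M T) (\<lambda>\<omega>. (X \<omega>, Y \<omega>)))"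
    using F by (subst nn_integral_distr) auto
  also have "\<dots> = (\<integral>\<^sup>+x. (\<integral>\<^sup>+y. F (x, y) \<partial>distr \<Omega> T Y) \<partial>distr \<Omega> S X)"
    using F unfolding eq[symmetric]
    by (subst Y.nn_integral_fst[symmetric]) (auto cong: measurable_cong_sets)
  also have "\<dots> = (\<integral>\<^sup>+x. (\<integral>\<^sup>+\<omega>'. F (x, Y \<omega>') \<partial>\<Omega>) \<partial>distr \<Omega> S X)"
    using F by (intro nn_integral_cong nn_integral_distr) auto
  also have "\<dots> = (\<integral>\<^sup>+\<omega>. (\<integral>\<^sup>+\<omega>'. F (X \<omega>, Y \<omega>') \<partial>\<Omega>) \<partial>\<Omega>)"
    using F by (subst nn_integral_distr) auto
  finally show ?thesis .
qed

text \<open>On \<open>t \<ge> 0\<close>, the survival function of the Erlang law of unit rate with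
  \<open>j + 1\<close> stages; \<open>erlang_density\<close> is indexed by \<open>j\<close>, one
  less than the number of stages.\<close>

abbreviation erlang_tail :: "nat \<Rightarrow> real \<Rightarrow> real" where
  "erlang_tail j t \<equiv> (\<Sum>m\<in>{0..j}. t ^ m / fact m * exp (- t))"

lemma emeasure_erlang_tail:
  "emeasure (density lborel (erlang_density j 1)) {t<..} = ennreal (if t < 0 then 1 else erlang_tail j t)"
proof -
  interpret prob_space "density lborel (erlang_density j 1)" by (rule prob_space_erlang_density) simp
  have "prob {..t} = erlang_CDF j 1 t"
    using emeasure_erlang_density[of 1 j t] by (simp add: emeasure_eq_measure)
  moreover have "prob {t<..} = 1 - prob {..t}"
    using prob_compl[of "{..t}"] by (simp add: Compl_eq_Diff_UNIV[symmetric])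
  ultimately show ?thesis
    by (simp add: emeasure_eq_measure erlang_CDF_def atMost_atLeast0)
qed

lemma erlang_tail_nonneg: "0 \<le> t \<Longrightarrow> 0 \<le> erlang_tail j t"
  by (intro sum_nonneg mult_nonneg_nonneg divide_nonneg_nonneg) auto

text \<open>The hypothesis \<open>tail\<close> treats constant thresholds. Restricted to
  \<open>H\<close>, it makes the joint law of \<open>W\<close> and the truncated gain a product of
  the law of \<open>W\<close> and an Erlang law; integrating over the region above the graph of
  \<open>\<tau>\<close> then allows a threshold that depends on \<open>W\<close>.\<close>

lemma emeasure_exceeds_random_threshold:
  fixes g :: "'w \<Rightarrow> real"
  assumes ps: "prob_space \<Omega>" and [measurable]: "W \<in> measurable \<Omega> S" "g \<in> borel_measurable \<Omega>"
    and [measurable]: "{\<omega> \<in> space \<Omega>. H \<omega>} \<in> sets \<Omega>"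
    and tail: "\<And>t E. 0 \<le> t \<Longrightarrow> E \<in> sets S \<Longrightarrow>
      measure \<Omega> {\<omega> \<in> space \<Omega>. H \<omega> \<and> W \<omega> \<in> E \<and> t < g \<omega>} =
      erlang_tail j t * measure \<Omega> {\<omega> \<in> space \<Omega>. H \<omega> \<and> W \<omega> \<in> E}"
    and \<tau>[measurable]: "\<tau> \<in> borel_measurable S" and \<tau>0: "\<And>w. w \<in> space S \<Longrightarrow> 0 \<le> \<tau> w"
  shows "emeasure \<Omega> {\<omega> \<in> space \<Omega>. H \<omega> \<and> \<tau> (W \<omega>) < g \<omega>} =
    (\<integral>\<^sup>+\<omega>. indicator {\<omega>. H \<omega>} \<omega> * ennreal (erlang_tail j (\<tau> (W \<omega>))) \<partial>\<Omega>)"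
proof -
  interpret prob_space \<Omega> by fact
  let ?H = "{\<omega> \<in> space \<Omega>. H \<omega>}"
  let ?\<gamma> = "density lborel (erlang_density j 1)"
  let ?\<Omega>' = "density \<Omega> (indicator ?H)"
  \<comment> \<open>\<open>tail\<close> says nothing about negative arguments; truncating at \<open>0\<close> fixes the law of the gain.\<close>
  let ?Z = "\<lambda>\<omega>. (W \<omega>, max 0 (g \<omega>))"
  interpret G: prob_space ?\<gamma> by (rule prob_space_erlang_density) simp
  have dens: "emeasure ?\<Omega>' A = emeasure \<Omega> (?H \<inter> A)" if "A \<in> events" for A
    using that by (simp add: emeasure_restricted)
  have fin: "finite_measure (distr ?\<Omega>' S W)"
    by (rule finite_measureI) (simp add: emeasure_distr dens emeasure_eq_measure)
  interpret W: finite_measure "distr ?\<Omega>' S W" by (rule fin)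
  have eq: "distr ?\<Omega>' S W \<Otimes>\<^sub>M ?\<gamma> = distr ?\<Omega>' (S \<Otimes>\<^sub>M borel) ?Z"
  proof (rule pair_measure_eqI)
    show "sigma_finite_measure (distr ?\<Omega>' S W)" "sigma_finite_measure ?\<gamma>"
      by (rule W.sigma_finite_measure_axioms G.sigma_finite_measure_axioms)+
    show "sets (distr ?\<Omega>' S W \<Otimes>\<^sub>M ?\<gamma>) = sets (distr ?\<Omega>' (S \<Otimes>\<^sub>M borel) ?Z)"
      by (simp cong: sets_pair_measure_cong)
    fix A B assume AB: "A \<in> sets (distr ?\<Omega>' S W)" "B \<in> sets ?\<gamma>"
    then have [measurable]: "A \<in> sets S" "B \<in> sets borel" by auto
    define a where "a = emeasure \<Omega> {\<omega> \<in> space \<Omega>. H \<omega> \<and> W \<omega> \<in> A}"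
    \<comment> \<open>Law of the truncated gain on the part of \<open>H\<close> where
      \<open>W\<close> lies in \<open>A\<close>. Rays identify it as \<open>a\<close> times the
      Erlang law, which yields every Borel set \<open>B\<close> of the rectangle.\<close>
    define N where "N = distr (density \<Omega> (indicator {\<omega> \<in> space \<Omega>. H \<omega> \<and> W \<omega> \<in> A})) borel (\<lambda>\<omega>. max 0 (g \<omega>))"
    have [measurable]: "{\<omega> \<in> space \<Omega>. H \<omega> \<and> W \<omega> \<in> A} \<in> events" by measurable
    have N: "emeasure N C = emeasure \<Omega> {\<omega> \<in> space \<Omega>. H \<omega> \<and> W \<omega> \<in> A \<and> max 0 (g \<omega>) \<in> C}"
      if [measurable]: "C \<in> sets borel" for C
    proof -
      have "emeasure N C = emeasure \<Omega> ({\<omega> \<in> space \<Omega>. H \<omega> \<and> W \<omega> \<in> A} \<inter> ((\<lambda>\<omega>. max 0 (g \<omega>)) -` C \<inter> space \<Omega>))"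
        unfolding N_def by (simp add: emeasure_distr emeasure_restricted)
      also have "{\<omega> \<in> space \<Omega>. H \<omega> \<and> W \<omega> \<in> A} \<inter> ((\<lambda>\<omega>. max 0 (g \<omega>)) -` C \<inter> space \<Omega>) =
          {\<omega> \<in> space \<Omega>. H \<omega> \<and> W \<omega> \<in> A \<and> max 0 (g \<omega>) \<in> C}" by auto
      finally show ?thesis .
    qed
    have "N = density ?\<gamma> (\<lambda>_. a)"
    proof (rule measure_eqI_lessThan)
      fix t :: real
      show "emeasure N {t<..} < \<infinity>" by (simp add: N emeasure_eq_measure)
      show "emeasure N {t<..} = emeasure (density ?\<gamma> (\<lambda>_. a)) {t<..}"
      proof (cases "t < 0")
        case True
        then have "t < max 0 (g \<omega>)" for \<omega> by auto
        then show ?thesis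
          using True by (simp add: N emeasure_density_const emeasure_erlang_tail a_def)
      next
        case False
        then have "t < max 0 (g \<omega>) \<longleftrightarrow> t < g \<omega>" for \<omega> by auto
        then show ?thesis
          using False tail[of t A] erlang_tail_nonneg[of t j]
          by (simp add: N emeasure_density_const emeasure_erlang_tail a_def
              emeasure_eq_measure ennreal_mult'' mult.commute)
      qed
    qed (simp_all add: N_def)
    then have "emeasure N B = a * emeasure ?\<gamma> B"
      by (simp add: emeasure_density_const)
    moreover have "emeasure (distr ?\<Omega>' S W) A = a"
    proof -
      have "?H \<inter> (W -` A \<inter> space \<Omega>) = {\<omega> \<in> space \<Omega>. H \<omega> \<and> W \<omega> \<in> A}" by auto
      then show ?thesis by (simp add: emeasure_distr dens a_def)
    qed
    moreover have "emeasure (distr ?\<Omega>' (S \<Otimes>\<^sub>M borel) ?Z) (A \<times> B) = emeasure N B"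
    proof -
      have "?H \<inter> (?Z -` (A \<times> B) \<inter> space \<Omega>) = {\<omega> \<in> space \<Omega>. H \<omega> \<and> W \<omega> \<in> A \<and> max 0 (g \<omega>) \<in> B}" by auto
      then show ?thesis by (simp add: emeasure_distr dens N)
    qed
    ultimately show "emeasure (distr ?\<Omega>' S W) A * emeasure ?\<gamma> B =
        emeasure (distr ?\<Omega>' (S \<Otimes>\<^sub>M borel) ?Z) (A \<times> B)" by simp
  qed
  have [measurable]: "{z \<in> space (S \<Otimes>\<^sub>M borel). \<tau> (fst z) < snd z} \<in> sets (S \<Otimes>\<^sub>M borel)"
    by measurable
  let ?C = "{z \<in> space (S \<Otimes>\<^sub>M borel). \<tau> (fst z) < snd z}"
  have \<tau>W: "0 \<le> \<tau> (W \<omega>)" "W \<omega> \<in> space S" if "\<omega> \<in> space \<Omega>" for \<omega>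
    using \<tau>0 measurable_space[of W \<Omega> S] that by auto
  \<comment> \<open>The truncation is harmless because the threshold is nonnegative.\<close>
  have "?H \<inter> (?Z -` ?C \<inter> space \<Omega>) = {\<omega> \<in> space \<Omega>. H \<omega> \<and> \<tau> (W \<omega>) < g \<omega>}"
    using \<tau>W by (auto simp: space_pair_measure less_max_iff_disj not_less[symmetric])
  then have "emeasure \<Omega> {\<omega> \<in> space \<Omega>. H \<omega> \<and> \<tau> (W \<omega>) < g \<omega>} = emeasure (distr ?\<Omega>' (S \<Otimes>\<^sub>M borel) ?Z) ?C"
    by (simp add: emeasure_distr dens)
  also have "\<dots> = (\<integral>\<^sup>+w. emeasure ?\<gamma> (Pair w -` ?C) \<partial>distr ?\<Omega>' S W)"
    unfolding eq[symmetric] by (rule G.emeasure_pair_measure_alt) (simp cong: sets_pair_measure_cong)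
  also have "\<dots> = (\<integral>\<^sup>+w. ennreal (erlang_tail j (\<tau> w)) \<partial>distr ?\<Omega>' S W)"
  proof (rule nn_integral_cong)
    fix w assume "w \<in> space (distr ?\<Omega>' S W)"
    then have w: "w \<in> space S" by simp
    then have "Pair w -` ?C = {\<tau> w<..}" by (auto simp: space_pair_measure)
    then show "emeasure ?\<gamma> (Pair w -` ?C) = ennreal (erlang_tail j (\<tau> w))"
      using \<tau>0[OF w] by (simp add: emeasure_erlang_tail)
  qed
  also have "\<dots> = (\<integral>\<^sup>+\<omega>. ennreal (erlang_tail j (\<tau> (W \<omega>))) \<partial>?\<Omega>')"
    by (rule nn_integral_distr) measurable
  also have "\<dots> = (\<integral>\<^sup>+\<omega>. indicator ?H \<omega> * ennreal (erlang_tail j (\<tau> (W \<omega>))) \<partial>\<Omega>)"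
    by (rule nn_integral_density) measurable
  also have "\<dots> = (\<integral>\<^sup>+\<omega>. indicator {\<omega>. H \<omega>} \<omega> * ennreal (erlang_tail j (\<tau> (W \<omega>))) \<partial>\<Omega>)"
    by (rule nn_integral_cong) (simp add: indicator_def)
  finally show ?thesis .
qed

section \<open>The area of a lens\<close>

text \<open>The integrand is the length of the chord at first coordinate \<open>t\<close>, with
  antiderivative \<open>G\<close>. The interior form of the fundamental theorem is needed since
  \<open>sqrt\<close> and \<open>arccos\<close> have no derivative where the chord
  degenerates.\<close>

lemma has_integral_chord:
  fixes R a :: real
  assumes R: "0 < R" and a: "-R \<le> a" "a \<le> R"
  shows "((\<lambda>t. 2 * sqrt (R\<^sup>2 - t\<^sup>2)) has_integral (R\<^sup>2 * arccos (a / R) - a * sqrt (R\<^sup>2 - a\<^sup>2))) {a..R}"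
proof -
  define G where "G = (\<lambda>t. t * sqrt (R\<^sup>2 - t\<^sup>2) - R\<^sup>2 * arccos (t / R))"
  have "((\<lambda>t. 2 * sqrt (R\<^sup>2 - t\<^sup>2)) has_integral (G R - G a)) {a..R}"
  proof (rule fundamental_theorem_of_calculus_interior[OF \<open>a \<le> R\<close>])
    show "continuous_on {a..R} G"
      unfolding G_def using R a
      by (intro continuous_intros) (auto simp: field_simps)
  next
    fix t assume t: "t \<in> {a<..<R}"
    have tR: "\<bar>t\<bar> < R" using t a by auto
    have sq: "t\<^sup>2 < R\<^sup>2" using tR by (metis abs_of_pos R power2_strict_mono)
    define s where "s = sqrt (R\<^sup>2 - t\<^sup>2)"
    have s: "s > 0" "s\<^sup>2 = R\<^sup>2 - t\<^sup>2" using sq by (auto simp: s_def)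
    have q: "sqrt (1 - (t / R)\<^sup>2) = s / R"
    proof -
      have "1 - (t / R)\<^sup>2 = (s / R)\<^sup>2" using s R by (simp add: field_simps)
      then show ?thesis using s R by simp
    qed
    have h1: "((\<lambda>t. sqrt (R\<^sup>2 - t\<^sup>2)) has_real_derivative (- (2 * t) / (2 * s))) (at t)"
    proof -
      have "((\<lambda>t. R\<^sup>2 - t\<^sup>2) has_real_derivative (- (2 * t))) (at t)"
        by (auto intro!: derivative_eq_intros)
      from DERIV_chain2[OF DERIV_real_sqrt this] sq
      show ?thesis by (simp add: s_def field_simps)
    qed
    have h2: "((\<lambda>t. arccos (t / R)) has_real_derivative (- inverse (s / R) * (1 / R))) (at t)"
    proof -
      have "- 1 < t / R" "t / R < 1" using tR R by (auto simp: pos_less_divide_eq)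
      from DERIV_chain2[OF DERIV_arccos[OF this] DERIV_cdivide[OF DERIV_ident]]
      show ?thesis unfolding q by simp
    qed
    have "(G has_real_derivative (s + t * (- (2 * t) / (2 * s)) - R\<^sup>2 * (- inverse (s / R) * (1 / R)))) (at t)"
      unfolding G_def
      by (rule DERIV_cong[OF DERIV_diff[OF DERIV_mult[OF DERIV_ident h1] DERIV_cmult[OF h2]]])
        (simp add: s_def)
    also have "s + t * (- (2 * t) / (2 * s)) - R\<^sup>2 * (- inverse (s / R) * (1 / R)) = 2 * s"
    proof -
      have "R * R = s * s + t * t" using s by (simp add: power2_eq_square)
      then show ?thesis using s(1) R
        by (simp add: field_simps power2_eq_square)
    qed
    finally show "(G has_vector_derivative 2 * sqrt (R\<^sup>2 - t\<^sup>2)) (at t)"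
      by (simp add: s_def has_real_derivative_iff_has_vector_derivative)
  qed
  also have "G R - G a = R\<^sup>2 * arccos (a / R) - a * sqrt (R\<^sup>2 - a\<^sup>2)"
    using R by (simp add: G_def)
  finally show ?thesis .
qed

text \<open>Slicing by the first coordinate, carried out on pairs, where \<open>lborel\<close> is a
  product measure.\<close>

lemma emeasure_disk_segment:
  fixes R a :: real
  assumes R: "0 < R" and a: "-R \<le> a" "a \<le> R"
  shows "emeasure (lborel :: (real \<times> real) measure) {z. a \<le> fst z \<and> (fst z)\<^sup>2 + (snd z)\<^sup>2 \<le> R\<^sup>2} =
    ennreal (R\<^sup>2 * arccos (a / R) - a * sqrt (R\<^sup>2 - a\<^sup>2))"
proof -
  let ?S = "{z::real\<times>real. a \<le> fst z \<and> (fst z)\<^sup>2 + (snd z)\<^sup>2 \<le> R\<^sup>2}"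
  have S: "?S \<in> sets (lborel \<Otimes>\<^sub>M lborel)"
    unfolding lborel_prod sets_lborel
    by (intro borel_closed closed_Collect_conj closed_Collect_le continuous_intros)
  have slice: "emeasure lborel (Pair t -` ?S) = ennreal (indicator {a..R} t * (2 * sqrt (R\<^sup>2 - t\<^sup>2)))" for t
  proof (cases "t \<in> {a..R}")
    case True
    then have "\<bar>t\<bar> \<le> R" using a by auto
    then have sq: "t\<^sup>2 \<le> R\<^sup>2" using R by (metis abs_le_square_iff abs_of_pos)
    have "Pair t -` ?S = {- sqrt (R\<^sup>2 - t\<^sup>2) .. sqrt (R\<^sup>2 - t\<^sup>2)}"
    proof -
      have "t\<^sup>2 + u\<^sup>2 \<le> R\<^sup>2 \<longleftrightarrow> \<bar>u\<bar> \<le> sqrt (R\<^sup>2 - t\<^sup>2)" for u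
        using real_sqrt_le_iff[of "u\<^sup>2" "R\<^sup>2 - t\<^sup>2"] by auto
      then have "(t, u) \<in> ?S \<longleftrightarrow> u \<in> {- sqrt (R\<^sup>2 - t\<^sup>2) .. sqrt (R\<^sup>2 - t\<^sup>2)}" for u
        using True unfolding abs_le_iff by fastforce
      then show ?thesis by blast
    qed
    then show ?thesis using True sq by simp
  next
    case False
    have "Pair t -` ?S = {}"
    proof (cases "t < a")
      case True then show ?thesis by auto
    next
      case F: False
      then have "R < t" using False by auto
      then have "R\<^sup>2 < t\<^sup>2 + u\<^sup>2" for u
        using R power_strict_mono[of R t 2] zero_le_power2[of u] by linarith
      then show ?thesis by (auto simp: not_le)
    qed
    then show ?thesis unfolding \<open>Pair t -` ?S = {}\<close> using False by simp
  qed
  have "emeasure (lborel \<Otimes>\<^sub>M lborel) ?S = (\<integral>\<^sup>+t. emeasure lborel (Pair t -` ?S) \<partial>lborel)"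
    by (rule lborel.emeasure_pair_measure_alt[OF S])
  also have "\<dots> = (\<integral>\<^sup>+t. ennreal (indicator {a..R} t * (2 * sqrt (R\<^sup>2 - t\<^sup>2))) \<partial>lborel)"
    by (simp only: slice)
  also have "\<dots> = ennreal (R\<^sup>2 * arccos (a / R) - a * sqrt (R\<^sup>2 - a\<^sup>2))"
  proof (rule nn_integral_has_integral_lebesgue[OF _ has_integral_chord[OF R a]])
    fix t assume "t \<in> {a..R}"
    then have "\<bar>t\<bar> \<le> R" using a by auto
    then have sq: "t\<^sup>2 \<le> R\<^sup>2" using R by (metis abs_le_square_iff abs_of_pos)
    then show "0 \<le> 2 * sqrt (R\<^sup>2 - t\<^sup>2)" by simp
  qed
  finally show ?thesis by (simp add: lborel_prod)
qed

text \<open>Carries results on pairs over to \<open>real ^ 2\<close>; agreement on boxes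
  suffices.\<close>

lemma distr_lborel_vector2:
  "distr (lborel :: (real \<times> real) measure) borel (\<lambda>z. vector [fst z, snd z] :: real ^ 2) = lborel"
proof (rule sym, rule lborel_eqI)
  let ?T = "\<lambda>z::real\<times>real. vector [fst z, snd z] :: real ^ 2"
  have T: "?T = (\<lambda>z. fst z *\<^sub>R axis 1 1 + snd z *\<^sub>R axis 2 1)"
    by (auto simp: fun_eq_iff vec_eq_iff forall_2 axis_def)
  have [measurable]: "?T \<in> borel_measurable borel"
    unfolding T by (intro borel_measurable_continuous_onI continuous_intros)
  fix l u :: "real^2" assume le: "\<And>b. b \<in> Basis \<Longrightarrow> l \<bullet> b \<le> u \<bullet> b"
  have le': "l $ 1 \<le> u $ 1" "l $ 2 \<le> u $ 2"
    using le[of "axis 1 1"] le[of "axis 2 1"] by (auto simp: axis_in_Basis_iff inner_axis)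
  have B2: "(Basis :: (real^2) set) = {axis 1 1, axis 2 1}"
    by (auto simp: Basis_vec_def exhaust_2)
      (metis (full_types) exhaust_2)
  have ne: "axis 1 1 \<noteq> (axis 2 1 :: real^2)" by (simp add: axis_eq_axis)
  have "?T -` box l u = box (l$1, l$2) (u$1, u$2)"
    by (auto simp: mem_box_cart forall_2 box_prod mem_box)
  also have "\<dots> = {l$1<..<u$1} \<times> {l$2<..<u$2}"
    by (simp add: box_prod box_real)
  finally have "emeasure (distr lborel borel ?T) (box l u) = emeasure (lborel \<Otimes>\<^sub>M lborel) ({l$1<..<u$1} \<times> {l$2<..<u$2})"
    by (subst emeasure_distr) (simp_all add: lborel_prod)
  also have "\<dots> = ennreal (u$1 - l$1) * ennreal (u$2 - l$2)"
    using le' by (subst lborel.emeasure_pair_measure_Times) simp_all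
  also have "\<dots> = ennreal (\<Prod>b\<in>{axis 1 1, axis 2 1}. (u - l) \<bullet> b)"
    using le' ne by (simp add: ennreal_mult inner_axis)
  finally show "emeasure (distr lborel borel ?T) (box l u) = (\<Prod>b\<in>Basis. (u - l) \<bullet> b)"
    by (simp only: B2)
qed simp

lemma measure_disk_segment_cart:
  fixes R a :: real
  assumes R: "0 < R" and a: "-R \<le> a" "a \<le> R"
  shows "emeasure (lborel :: loc measure) {z. a \<le> z $ 1 \<and> norm z \<le> R} =
    ennreal (R\<^sup>2 * arccos (a / R) - a * sqrt (R\<^sup>2 - a\<^sup>2))"
proof -
  let ?T = "\<lambda>z::real\<times>real. vector [fst z, snd z] :: real ^ 2"
  have T: "?T = (\<lambda>z. fst z *\<^sub>R axis 1 1 + snd z *\<^sub>R axis 2 1)"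
    by (auto simp: fun_eq_iff vec_eq_iff forall_2 axis_def)
  have [measurable]: "?T \<in> borel_measurable borel"
    unfolding T by (intro borel_measurable_continuous_onI continuous_intros)
  have [measurable]: "{z :: loc. a \<le> z $ 1 \<and> norm z \<le> R} \<in> sets borel"
    by (intro borel_closed closed_Collect_conj closed_Collect_le continuous_intros)
  have n: "norm z \<le> R \<longleftrightarrow> (z$1)\<^sup>2 + (z$2)\<^sup>2 \<le> R\<^sup>2" for z :: loc
    using R real_sqrt_le_iff[of "(z$1)\<^sup>2 + (z$2)\<^sup>2" "R\<^sup>2"]
    by (simp add: norm_vec_def L2_set_def UNIV_2)
  have "emeasure (lborel :: loc measure) {z. a \<le> z $ 1 \<and> norm z \<le> R} =
    emeasure lborel (?T -` {z. a \<le> z $ 1 \<and> norm z \<le> R})"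
    by (subst distr_lborel_vector2[symmetric], subst emeasure_distr) auto
  also have "?T -` {z. a \<le> z $ 1 \<and> norm z \<le> R} = {z. a \<le> fst z \<and> (fst z)\<^sup>2 + (snd z)\<^sup>2 \<le> R\<^sup>2}"
    by (auto simp: n)
  finally show ?thesis using emeasure_disk_segment[OF assms] by simp
qed

lemma lebesgue_measure_disk_segment:
  fixes R a :: real
  assumes R: "0 < R" and a: "-R \<le> a" "a \<le> R"
  defines "S \<equiv> {z :: loc. a \<le> z $ 1 \<and> norm z \<le> R}"
  shows "S \<in> lmeasurable"
    and "measure lebesgue S = R\<^sup>2 * arccos (a / R) - a * sqrt (R\<^sup>2 - a\<^sup>2)"
proof -
  have S: "S \<in> sets borel"
    unfolding S_def by (intro borel_closed closed_Collect_conj closed_Collect_le continuous_intros)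
  have e: "emeasure lborel S = ennreal (R\<^sup>2 * arccos (a / R) - a * sqrt (R\<^sup>2 - a\<^sup>2))"
    unfolding S_def by (rule measure_disk_segment_cart[OF R a])
  then show "S \<in> lmeasurable"
    using S by (auto intro!: fmeasurableI simp: emeasure_completion)
  \<comment> \<open>\<open>ennreal\<close> truncates negative numbers, so the sign must be known
    before it can be removed; it is read off from the integral of chord lengths.\<close>
  have "0 \<le> R\<^sup>2 * arccos (a / R) - a * sqrt (R\<^sup>2 - a\<^sup>2)"
  proof (rule has_integral_nonneg[OF has_integral_chord[OF R a]])
    fix t assume "t \<in> {a..R}"
    then have "\<bar>t\<bar> \<le> R" using a by auto
    then have sq: "t\<^sup>2 \<le> R\<^sup>2" using R by (metis abs_le_square_iff abs_of_pos)
    then show "0 \<le> 2 * sqrt (R\<^sup>2 - t\<^sup>2)" by simp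
  qed
  then show "measure lebesgue S = R\<^sup>2 * arccos (a / R) - a * sqrt (R\<^sup>2 - a\<^sup>2)"
    using S e by (simp add: measure_def emeasure_completion)
qed

lemma norm_diff_axis_square:
  fixes z :: loc
  shows "(norm (z - axis 1 x))\<^sup>2 = (norm z)\<^sup>2 - 2 * x * z $ 1 + x\<^sup>2"
  unfolding power2_norm_eq_inner
  by (simp add: inner_diff inner_axis inner_commute[of "axis 1 x" z] power2_eq_square algebra_simps)

text \<open>The chord \<open>z $ 1 = a\<close> cuts the lens into two segments: to its right the
  disk about the origin is the binding constraint, to its left the other disk. The point reflection
  \<open>\<lambda>z. axis 1 x - z\<close> moves the left one to a disk about the origin with chord
  at \<open>x - a\<close>. Either chord coordinate may be negative; \<open>arccos\<close> then
  covers a segment larger than half a disk.\<close>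

lemma measure_lens_axis:
  fixes D x r :: real
  assumes x: "0 < x" and D: "0 < D" and r: "0 < r" and r1: "\<bar>D - x\<bar> \<le> r" and r2: "r \<le> D + x"
  shows "measure lebesgue (cball 0 r \<inter> cball (axis 1 x) D :: loc set) = lens_area D x r"
proof -
  \<comment> \<open>first coordinate of the common chord of the two circles\<close>
  define a where "a = (r\<^sup>2 + x\<^sup>2 - D\<^sup>2) / (2 * x)"
  have xa: "x - a = (D\<^sup>2 + x\<^sup>2 - r\<^sup>2) / (2 * x)"
    using x by (simp add: a_def field_simps power2_eq_square)
  \<comment> \<open>Squared triangle inequalities for sides \<open>r\<close>, \<open>x\<close>,
    \<open>D\<close>; they place the chord within both disks.\<close>
  have b1: "(D - x)\<^sup>2 \<le> r\<^sup>2" using r1 r by (metis abs_le_square_iff abs_of_pos)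
  have b2: "r\<^sup>2 \<le> (D + x)\<^sup>2" using r r2 by (intro power_mono) auto
  have b3: "(r - x)\<^sup>2 \<le> D\<^sup>2"
  proof -
    have "\<bar>r - x\<bar> \<le> \<bar>D\<bar>" using r1 r2 x D by linarith
    then show ?thesis by (simp add: abs_le_square_iff)
  qed
  have b4: "D\<^sup>2 \<le> (r + x)\<^sup>2" using r1 D by (intro power_mono) auto
  have a: "-r \<le> a" "a \<le> r" and a': "-D \<le> x - a" "x - a \<le> D"
    unfolding xa unfolding a_def using b1 b2 b3 b4 x
    by (simp_all add: pos_le_divide_eq pos_divide_le_eq power2_eq_square algebra_simps)
  let ?e = "axis 1 x :: loc"
  let ?A1 = "{z :: loc. a \<le> z $ 1 \<and> norm z \<le> r}"
  let ?A2' = "{z :: loc. x - a \<le> z $ 1 \<and> norm z \<le> D}"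
  let ?A2 = "(+) ?e ` uminus ` ?A2'"
  note A1 = lebesgue_measure_disk_segment[OF r a]
  note A2' = lebesgue_measure_disk_segment[OF D a']
  have o: "orthogonal_transformation (uminus :: loc \<Rightarrow> loc)"
    by (simp add: orthogonal_transformation_def linear_uminus)
  have A2: "?A2 \<in> lmeasurable"
    "measure lebesgue ?A2 = D\<^sup>2 * arccos ((x - a) / D) - (x - a) * sqrt (D\<^sup>2 - (x - a)\<^sup>2)"
    using A2' measurable_orthogonal_image[OF o A2'(1)]
    by (auto simp: measure_translation measurable_translation measure_orthogonal_image[OF o])
  have A2_alt: "?A2 = {z. z $ 1 \<le> a \<and> norm (z - ?e) \<le> D}"
  proof (intro set_eqI iffI)
    fix z assume "z \<in> {z. z $ 1 \<le> a \<and> norm (z - ?e) \<le> D}"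
    then have "?e - z \<in> ?A2'" by (simp add: norm_minus_commute axis_def)
    then show "z \<in> ?A2" by (intro image_eqI[of _ _ "z - ?e"] image_eqI[of _ _ "?e - z"]) auto
  qed (auto simp: axis_def)
  \<comment> \<open>The powers of \<open>z\<close> with respect to the two circles differ by a
    linear function of \<open>z $ 1\<close> that vanishes on the chord; its sign tells which disk is
    binding.\<close>
  have key: "(norm z)\<^sup>2 - r\<^sup>2 = (norm (z - ?e))\<^sup>2 - D\<^sup>2 + 2 * x * (z $ 1 - a)" for z :: loc
    unfolding norm_diff_axis_square using x by (simp add: a_def field_simps)
  have sqr: "norm z \<le> r \<longleftrightarrow> (norm z)\<^sup>2 \<le> r\<^sup>2" "norm z \<le> D \<longleftrightarrow> (norm z)\<^sup>2 \<le> D\<^sup>2" for z :: loc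
    using r D by (simp_all add: abs_le_square_iff[symmetric])
  have lens: "cball 0 r \<inter> cball ?e D = ?A1 \<union> ?A2"
  proof (intro set_eqI)
    fix z :: loc
    have sgn: "z $ 1 \<le> a \<longleftrightarrow> 2 * x * (z $ 1 - a) \<le> 0" "a \<le> z $ 1 \<longleftrightarrow> 0 \<le> 2 * x * (z $ 1 - a)"
      using x by (simp_all add: mult_le_0_iff zero_le_mult_iff)
    have "z \<in> cball 0 r \<inter> cball ?e D \<longleftrightarrow> (norm z)\<^sup>2 \<le> r\<^sup>2 \<and> (norm (z - ?e))\<^sup>2 \<le> D\<^sup>2"
      by (simp add: sqr dist_norm norm_minus_commute)
    also have "\<dots> \<longleftrightarrow> (0 \<le> 2 * x * (z $ 1 - a) \<and> (norm z)\<^sup>2 \<le> r\<^sup>2) \<or> (2 * x * (z $ 1 - a) \<le> 0 \<and> (norm (z - ?e))\<^sup>2 \<le> D\<^sup>2)"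
      using key[of z] by linarith
    also have "\<dots> \<longleftrightarrow> z \<in> ?A1 \<union> ?A2"
      unfolding A2_alt by (simp add: sqr sgn)
    finally show "z \<in> cball 0 r \<inter> cball ?e D \<longleftrightarrow> z \<in> ?A1 \<union> ?A2" .
  qed
  have "negligible {z :: loc. z $ 1 = a}"
    using negligible_standard_hyperplane[of "axis 1 1 :: loc" a]
    by (simp add: inner_axis axis_in_Basis_iff)
  then have neg: "negligible (?A1 \<inter> ?A2)"
    by (rule negligible_subset) (auto simp: A2_alt)
  have "measure lebesgue (cball 0 r \<inter> cball ?e D) = measure lebesgue ?A1 + measure lebesgue ?A2"
    by (simp only: lens measure_Un3[OF A1(1) A2(1)] negligible_imp_measure0[OF neg] diff_zero)
  also have "\<dots> = lens_area D x r"
  proof -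
    \<comment> \<open>Both segments have the same half chord, so the subtracted terms add up to
      \<open>x\<close> times it. That is twice the area of the triangle with sides \<open>x\<close>,
      \<open>r\<close>, \<open>D\<close>, and Heron's formula gives the square root in
      \<open>lens_area\<close>.\<close>
    have xa': "2 * x * a = r\<^sup>2 + x\<^sup>2 - D\<^sup>2"
      using x by (simp add: a_def)
    then have eq: "D\<^sup>2 - (x - a)\<^sup>2 = r\<^sup>2 - a\<^sup>2"
      by (simp add: power2_diff)
    have "x * sqrt (r\<^sup>2 - a\<^sup>2) = 1 / 2 * sqrt ((2 * x)\<^sup>2 * (r\<^sup>2 - a\<^sup>2))"
      using x by (simp add: real_sqrt_mult)
    also have "(2 * x)\<^sup>2 * (r\<^sup>2 - a\<^sup>2) = (2 * x * r)\<^sup>2 - (2 * x * a)\<^sup>2"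
      by (simp add: power_mult_distrib right_diff_distrib)
    also note xa'
    also have "(2 * x * r)\<^sup>2 - (r\<^sup>2 + x\<^sup>2 - D\<^sup>2)\<^sup>2 = ((r + x)\<^sup>2 - D\<^sup>2) * (D\<^sup>2 - (r - x)\<^sup>2)"
      by algebra
    finally have h: "x * sqrt (r\<^sup>2 - a\<^sup>2) = 1 / 2 * sqrt (((r + x)\<^sup>2 - D\<^sup>2) * (D\<^sup>2 - (r - x)\<^sup>2))" .
    have "a / r = (r\<^sup>2 + x\<^sup>2 - D\<^sup>2) / (2 * x * r)" "(x - a) / D = (D\<^sup>2 + x\<^sup>2 - r\<^sup>2) / (2 * x * D)"
      unfolding xa unfolding a_def by simp_all
    then show ?thesis
      unfolding A1(2) A2(2) lens_area_def eq h[symmetric] by (simp add: algebra_simps)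
  qed
  finally show ?thesis .
qed

text \<open>A rotation brings the centre onto the first axis.\<close>

lemma measure_lens:
  fixes c :: loc and D r :: real
  assumes "0 < norm c" "0 < D" "0 < r" "\<bar>D - norm c\<bar> \<le> r" "r \<le> D + norm c"
  shows "measure lborel (cball 0 r \<inter> cball c D) = lens_area D (norm c) r"
proof -
  obtain f :: "loc \<Rightarrow> loc" where f: "orthogonal_transformation f" "f (axis 1 (norm c)) = c"
    by (rule orthogonal_transformation_exists[of "axis 1 (norm c)" c]) (auto simp: norm_eq_sqrt_inner inner_axis)
  let ?L = "cball 0 r \<inter> cball (axis 1 (norm c)) D :: loc set"
  have "f ` ?L = cball 0 r \<inter> cball c D"
    using f image_orthogonal_transformation_cball[OF f(1)]
    by (simp add: image_Int orthogonal_transformation_inj orthogonal_transformation_linear linear_0)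
  moreover have "measure lebesgue (f ` ?L) = measure lebesgue ?L"
    by (rule measure_orthogonal_image[OF f(1)]) (auto intro!: fmeasurable_Int_fmeasurable)
  moreover have "measure lebesgue (cball 0 r \<inter> cball c D) = measure lborel (cball 0 r \<inter> cball c D)"
    by (rule measure_completion) simp
  ultimately show ?thesis using measure_lens_axis[OF assms] by simp
qed

section \<open>The density of the distance\<close>

text \<open>Given by measure, not by formula, so that it also makes sense for \<open>c = 0\<close>
  and outside the range where the two circles meet.\<close>

definition disk_overlap :: "loc \<Rightarrow> real \<Rightarrow> real \<Rightarrow> real" where
  "disk_overlap c D r = measure lborel (cball 0 r \<inter> cball c D)"

lemma measure_disk:
  fixes c :: loc
  assumes "0 \<le> r"
  shows "measure lborel (cball c r) = pi * r\<^sup>2"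
  using assms by (simp add: measure_def emeasure_cball unit_ball_vol_2)

lemma fmeasurable_lborel_cball [simp]: "cball (a :: 'a :: euclidean_space) r \<in> fmeasurable lborel"
  by (intro fmeasurableI emeasure_bounded_finite) auto

lemma fmeasurable_lborel_cball_Int [simp]:
  "cball (a :: 'a :: euclidean_space) r \<inter> cball b s \<in> fmeasurable lborel"
  by (intro fmeasurable_Int_fmeasurable) auto

lemma mono_disk_overlap: "mono (disk_overlap c D)"
  unfolding disk_overlap_def by (auto intro!: monoI measure_mono_fmeasurable)

lemma disk_overlap_le: "0 \<le> D \<Longrightarrow> disk_overlap c D r \<le> pi * D\<^sup>2"
  unfolding disk_overlap_def measure_disk[symmetric, of D c]
  by (intro measure_mono_fmeasurable) auto

lemma disk_overlap_inner:
  assumes "0 \<le> r" "r \<le> D - norm c"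
  shows "disk_overlap c D r = pi * r\<^sup>2"
proof -
  have "cball 0 r \<inter> cball c D = cball 0 r"
  proof (intro Int_absorb2 subsetI)
    fix z :: loc assume "z \<in> cball 0 r"
    then show "z \<in> cball c D"
      using assms norm_triangle_ineq4[of c z] by (simp add: dist_norm)
  qed
  then show ?thesis using assms by (simp add: disk_overlap_def measure_disk)
qed

lemma disk_overlap_outer:
  assumes "0 \<le> D" "D + norm c \<le> r"
  shows "disk_overlap c D r = pi * D\<^sup>2"
proof -
  have "cball 0 r \<inter> cball c D = cball c D"
  proof (intro Int_absorb1 subsetI)
    fix z :: loc assume "z \<in> cball c D"
    then show "z \<in> cball 0 r"
      using assms norm_triangle_ineq2[of z c] by (simp add: dist_norm norm_minus_commute)
  qed
  then show ?thesis using assms by (simp add: disk_overlap_def measure_disk)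
qed

text \<open>The added part of the overlap lies in the annulus between the two radii. This modulus
  gives continuity also at \<open>D - norm c\<close>, where no derivative is established.\<close>

lemma disk_overlap_increment:
  assumes "0 \<le> r" "r \<le> s"
  shows "disk_overlap c D s - disk_overlap c D r \<le> pi * s\<^sup>2 - pi * r\<^sup>2"
proof -
  have "disk_overlap c D s - disk_overlap c D r = measure lborel ((cball 0 s \<inter> cball c D) - (cball 0 r \<inter> cball c D))"
    unfolding disk_overlap_def using assms
    by (intro measurable_measure_Diff[symmetric]) auto
  also have "\<dots> \<le> measure lborel (cball 0 s - cball (0 :: loc) r)"
    by (intro measure_mono_fmeasurable fmeasurable_Diff) auto
  also have "\<dots> = pi * s\<^sup>2 - pi * r\<^sup>2"
    using assms by (subst measurable_measure_Diff) (auto simp: measure_disk)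
  finally show ?thesis .
qed

lemma continuous_on_disk_overlap:
  assumes "0 \<le> a"
  shows "continuous_on {a..b} (disk_overlap c D)"
  unfolding continuous_on_def
proof
  fix r assume r: "r \<in> {a..b}"
  have bound: "norm (disk_overlap c D s - disk_overlap c D r) \<le> \<bar>pi * s\<^sup>2 - pi * r\<^sup>2\<bar>"
    if "s \<in> {a..b}" for s
    using disk_overlap_increment[of r s c D] disk_overlap_increment[of s r c D]
      monoD[OF mono_disk_overlap, of r s c D] monoD[OF mono_disk_overlap, of s r c D] that r assms
    by (cases "r \<le> s") auto
  have "\<forall>\<^sub>F s in at r within {a..b}. s \<in> {a..b}"
    by (simp only: eventually_at_filter) simp
  then have ev: "\<forall>\<^sub>F s in at r within {a..b}.
      norm (disk_overlap c D s - disk_overlap c D r) \<le> \<bar>pi * s\<^sup>2 - pi * r\<^sup>2\<bar>"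
    by (rule eventually_mono) (rule bound)
  have lim: "((\<lambda>s. \<bar>pi * s\<^sup>2 - pi * r\<^sup>2\<bar>) \<longlongrightarrow> 0) (at r within {a..b})"
    by (auto intro!: tendsto_eq_intros)
  have "((\<lambda>s. disk_overlap c D s - disk_overlap c D r) \<longlongrightarrow> 0) (at r within {a..b})"
    by (rule Lim_null_comparison[OF ev lim])
  then show "(disk_overlap c D \<longlongrightarrow> disk_overlap c D r) (at r within {a..b})"
    using LIM_zero_cancel by blast
qed

section \<open>Differentiability of the overlap area\<close>

lemma differentiable_arccos:
  assumes "u differentiable (at (r :: real))" "- 1 < u r" "u r < 1"
  shows "(\<lambda>r. arccos (u r)) differentiable (at r)"
  using assms DERIV_chain2[OF DERIV_arccos] unfolding real_differentiable_def by blast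

lemma differentiable_sqrt:
  assumes "u differentiable (at (r :: real))" "0 < u r"
  shows "(\<lambda>r. sqrt (u r)) differentiable (at r)"
  using assms DERIV_chain2[OF DERIV_real_sqrt] unfolding real_differentiable_def by blast

text \<open>Strict triangle inequalities keep both \<open>arccos\<close> arguments inside the open
  interval from -1 to 1 and the radicand positive.\<close>

lemma differentiable_lens_area:
  assumes x: "0 < x" "x \<le> D" and r: "D - x < r" "r < D + x"
  shows "lens_area D x differentiable (at r)"
proof -
  have r0: "0 < r" and D: "0 < D" using x r by auto
  have b1: "(D - x)\<^sup>2 < r\<^sup>2" using r x by (intro power_strict_mono) auto
  have b2: "r\<^sup>2 < (D + x)\<^sup>2" using r r0 by (intro power_strict_mono) auto
  have b3: "(r - x)\<^sup>2 < D\<^sup>2"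
  proof -
    have "\<bar>r - x\<bar> < D" using r r0 x by linarith
    then show ?thesis by (metis abs_ge_zero power2_abs power_strict_mono zero_less_numeral)
  qed
  have b4: "D\<^sup>2 < (r + x)\<^sup>2" using r D by (intro power_strict_mono) auto
  have "0 < 2 * x * D" "0 < 2 * x * r" using x D r0 by auto
  note p = this
  have c1: "- 1 < (D\<^sup>2 + x\<^sup>2 - r\<^sup>2) / (2 * x * D)" "(D\<^sup>2 + x\<^sup>2 - r\<^sup>2) / (2 * x * D) < 1"
    using b1 b2 unfolding pos_less_divide_eq[OF p(1)] pos_divide_less_eq[OF p(1)]
    by (simp_all add: power2_eq_square algebra_simps)
  have c2: "- 1 < (r\<^sup>2 + x\<^sup>2 - D\<^sup>2) / (2 * x * r)" "(r\<^sup>2 + x\<^sup>2 - D\<^sup>2) / (2 * x * r) < 1"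
    using b3 b4 unfolding pos_less_divide_eq[OF p(2)] pos_divide_less_eq[OF p(2)]
    by (simp_all add: power2_eq_square algebra_simps)
  have c3: "0 < ((r + x)\<^sup>2 - D\<^sup>2) * (D\<^sup>2 - (r - x)\<^sup>2)"
    using b3 b4 by simp
  show ?thesis
    unfolding lens_area_def
    by (intro differentiable_add differentiable_diff differentiable_mult differentiable_const
        differentiable_arccos differentiable_sqrt differentiable_divide differentiable_power
        differentiable_ident c1 c2 c3) (use p in auto)
qed

lemma disk_overlap_lens:
  assumes "0 < norm c" "norm c \<le> D" "0 < r" "D - norm c \<le> r" "r \<le> D + norm c"
  shows "disk_overlap c D r = lens_area D (norm c) r"
  using assms measure_lens[of c D r] by (simp add: disk_overlap_def)

text \<open>Both branches of \<open>distance_density\<close> are one expression in the overlap area.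
  Under \<open>deriv\<close> the branch formula may replace that area only if the two agree near
  \<open>r\<close>, which is why \<open>D - norm c\<close> is excluded.\<close>

lemma disk_overlap_derivative:
  assumes c: "norm c \<le> D" and D: "0 < D"
    and r: "0 < r" "r < D + norm c" "r \<noteq> D - norm c"
  shows "disk_overlap c D differentiable (at r)"
    and "distance_density D (norm c) k r =
      real k / (pi * D\<^sup>2) * deriv (disk_overlap c D) r * (1 - disk_overlap c D r / (pi * D\<^sup>2)) ^ (k - 1)"
proof -
  consider (inner) "r < D - norm c" | (lens) "D - norm c < r" using r by linarith
  then have "disk_overlap c D differentiable (at r) \<and> distance_density D (norm c) k r =
      real k / (pi * D\<^sup>2) * deriv (disk_overlap c D) r * (1 - disk_overlap c D r / (pi * D\<^sup>2)) ^ (k - 1)"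
  proof cases
    case inner
    have "((\<lambda>r. pi * r\<^sup>2) has_real_derivative (2 * pi * r)) (at r)"
      by (auto intro!: derivative_eq_intros)
    then have d: "(disk_overlap c D has_real_derivative (2 * pi * r)) (at r)"
      by (rule has_field_derivative_transform_within_open[of _ _ _ "{0<..<D - norm c}"])
        (use inner r in \<open>auto simp: disk_overlap_inner\<close>)
    show ?thesis
      using d inner r D DERIV_imp_deriv[OF d]
      by (auto simp: real_differentiable_def distance_density_def disk_overlap_inner field_simps)
  next
    case lens
    then have x: "0 < norm c" using r by auto
    have ev: "eventually (\<lambda>s. lens_area D (norm c) s = disk_overlap c D s) (nhds r)"
      using r lens c x
      by (intro eventually_nhds_in_open[of "{D - norm c<..<D + norm c}", THEN eventually_mono])
        (auto simp: disk_overlap_lens)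
    have "lens_area D (norm c) differentiable (at r)"
      using differentiable_lens_area[OF x c lens] r by simp
    then obtain d where d: "(lens_area D (norm c) has_real_derivative d) (at r)"
      by (auto simp: real_differentiable_def)
    then have d': "(disk_overlap c D has_real_derivative d) (at r)"
      using DERIV_cong_ev[OF refl ev refl] by simp
    show ?thesis
      using d' lens r c x DERIV_imp_deriv[OF d] DERIV_imp_deriv[OF d'] eventually_nhds_x_imp_x[OF ev]
      by (auto simp: real_differentiable_def distance_density_def)
  qed
  then show "disk_overlap c D differentiable (at r)"
    and "distance_density D (norm c) k r =
      real k / (pi * D\<^sup>2) * deriv (disk_overlap c D) r * (1 - disk_overlap c D r / (pi * D\<^sup>2)) ^ (k - 1)"
    by auto
qed

section \<open>The density of the nearest distance: sign, measurability, tail integral\<close>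

lemma deriv_difference_quotient_tendsto:
  fixes F :: "real \<Rightarrow> real"
  assumes "F differentiable (at r)"
  shows "(\<lambda>n. (F (r + inverse (real (Suc n))) - F r) / inverse (real (Suc n))) \<longlonglongrightarrow> deriv F r"
proof -
  from assms have "(F has_real_derivative deriv F r) (at r)"
    using DERIV_deriv_iff_real_differentiable by blast
  then have "((\<lambda>h. (F (r + h) - F r) / h) \<longlongrightarrow> deriv F r) (at 0)"
    by (simp add: DERIV_def)
  then show ?thesis
    by (rule filterlim_compose)
      (auto intro!: filterlim_atI LIMSEQ_inverse_real_of_nat simp del: of_nat_Suc)
qed

lemma deriv_mono_nonneg:
  fixes F :: "real \<Rightarrow> real"
  assumes "mono F" "F differentiable (at r)"
  shows "0 \<le> deriv F r"
  by (rule LIMSEQ_le_const[OF deriv_difference_quotient_tendsto[OF assms(2)]])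
    (intro exI allI impI divide_nonneg_nonneg, auto intro!: monoD[OF assms(1)] simp del: of_nat_Suc)

text \<open>A pointwise limit of difference quotients, each measurable because \<open>F\<close> is
  monotone. The indicator discards points where \<open>deriv\<close> is unspecified.\<close>

lemma borel_measurable_deriv_mono:
  fixes F :: "real \<Rightarrow> real"
  assumes F: "mono F" and [measurable]: "U \<in> sets borel"
    and d: "\<And>r. r \<in> U \<Longrightarrow> F differentiable (at r)"
  shows "(\<lambda>r. indicator U r * deriv F r) \<in> borel_measurable borel"
proof (rule borel_measurable_LIMSEQ_real)
  have [measurable]: "F \<in> borel_measurable borel" by (rule borel_measurable_mono[OF F])
  show "(\<lambda>r. indicator U r * ((F (r + inverse (real (Suc n))) - F r) / inverse (real (Suc n))))
      \<in> borel_measurable borel" for n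
    by measurable
  show "(\<lambda>n. indicator U r * ((F (r + inverse (real (Suc n))) - F r) / inverse (real (Suc n))))
      \<longlonglongrightarrow> indicator U r * deriv F r" for r
    using deriv_difference_quotient_tendsto[OF d, of r]
    by (cases "r \<in> U") (auto intro!: tendsto_mult simp del: of_nat_Suc)
qed

text \<open>
  The points \<open>0\<close>, \<open>D - norm c\<close> and \<open>D + norm c\<close> are left out because \<open>disk_overlap c D\<close> or \<open>lens_area\<close>
  need not be differentiable there, and \<open>deriv\<close> is then unspecified.
\<close>

definition overlap_density :: "loc \<Rightarrow> real \<Rightarrow> nat \<Rightarrow> real \<Rightarrow> real" where
  "overlap_density c D k r = indicator ({0<..<D + norm c} - {D - norm c}) r *
     (real k / (pi * D\<^sup>2) * deriv (disk_overlap c D) r * (1 - disk_overlap c D r / (pi * D\<^sup>2)) ^ (k - 1))"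

lemma overlap_density_eq:
  assumes c: "norm c \<le> D" and D: "0 < D" and r: "r \<noteq> 0" "r \<noteq> D - norm c"
  shows "overlap_density c D k r = indicator {0..D + norm c} r * distance_density D (norm c) k r"
  using disk_overlap_derivative(2)[OF c D, of r k] r
  by (auto simp: overlap_density_def distance_density_def indicator_def)

lemma overlap_density_nonneg:
  assumes c: "norm c \<le> D" and D: "0 < D"
  shows "0 \<le> overlap_density c D k r"
  using disk_overlap_derivative(1)[OF c D, of r] disk_overlap_le[of D c r] D
  by (auto simp: overlap_density_def indicator_def field_simps
      intro!: mult_nonneg_nonneg zero_le_power deriv_mono_nonneg mono_disk_overlap)

lemma borel_measurable_overlap_density:
  assumes c: "norm c \<le> D" and D: "0 < D"
  shows "overlap_density c D k \<in> borel_measurable borel"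
proof -
  let ?U = "{0<..<D + norm c} - {D - norm c}"
  have [measurable]: "disk_overlap c D \<in> borel_measurable borel"
    by (rule borel_measurable_mono[OF mono_disk_overlap])
  have [measurable]: "(\<lambda>r. indicator ?U r * deriv (disk_overlap c D) r) \<in> borel_measurable borel"
    by (rule borel_measurable_deriv_mono[OF mono_disk_overlap])
      (auto intro!: disk_overlap_derivative(1) c D)
  have "overlap_density c D k = (\<lambda>r. real k / (pi * D\<^sup>2) * (indicator ?U r * deriv (disk_overlap c D) r) *
      (1 - disk_overlap c D r / (pi * D\<^sup>2)) ^ (k - 1))"
    by (auto simp: overlap_density_def fun_eq_iff)
  also have "\<dots> \<in> borel_measurable borel" by measurable
  finally show ?thesis .
qed

text \<open>The function \<open>\<lambda>r. - ((1 - ?F r / ?A) ^ k)\<close> is an antiderivative;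
  its continuity lets the fundamental theorem pass over the exceptional point
  \<open>D - norm c\<close>.\<close>

lemma nn_integral_overlap_density:
  assumes c: "norm c \<le> D" and D: "0 < D" and k: "1 \<le> k" and r0: "0 \<le> r0"
  shows "(\<integral>\<^sup>+r. ennreal (overlap_density c D k r) * indicator {r0<..} r \<partial>lborel) =
    ennreal ((1 - disk_overlap c D r0 / (pi * D\<^sup>2)) ^ k)"
proof (cases "r0 \<le> D + norm c")
  case True
  let ?A = "pi * D\<^sup>2" and ?F = "disk_overlap c D"
  have "(overlap_density c D k has_integral (- ((1 - ?F (D + norm c) / ?A) ^ k) - - ((1 - ?F r0 / ?A) ^ k))) {r0..D + norm c}"
  proof (rule fundamental_theorem_of_calculus_interior_strong[where S="{D - norm c}"])
    show "continuous_on {r0..D + norm c} (\<lambda>r. - ((1 - ?F r / ?A) ^ k))"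
      using continuous_on_disk_overlap[OF r0] D by (intro continuous_intros) auto
    fix r assume r: "r \<in> {r0<..<D + norm c} - {D - norm c}"
    then have "?F differentiable (at r)"
      using r0 by (intro disk_overlap_derivative(1)[OF c D]) auto
    then have F: "(?F has_real_derivative deriv ?F r) (at r)"
      using DERIV_deriv_iff_real_differentiable by blast
    have "((\<lambda>r. - ((1 - ?F r / ?A) ^ k)) has_real_derivative overlap_density c D k r) (at r)"
      using r r0 D by (auto intro!: derivative_eq_intros F simp: overlap_density_def)
    then show "((\<lambda>r. - ((1 - ?F r / ?A) ^ k)) has_vector_derivative overlap_density c D k r) (at r)"
      by (simp add: has_real_derivative_iff_has_vector_derivative)
  qed (use True in auto)
  \<comment> \<open>At the upper limit the base of the power is zero, and \<open>1 \<le> k\<close>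
    makes the boundary term vanish.\<close>
  also have "?F (D + norm c) = ?A" using D by (simp add: disk_overlap_outer)
  finally have int: "(overlap_density c D k has_integral (1 - ?F r0 / ?A) ^ k) {r0..D + norm c}"
    using D k by (simp add: power_0_left)
  have "(\<integral>\<^sup>+r. ennreal (overlap_density c D k r) * indicator {r0<..} r \<partial>lborel) =
      (\<integral>\<^sup>+r. ennreal (overlap_density c D k r) * indicator {r0..D + norm c} r \<partial>lborel)"
  proof (rule nn_integral_cong_AE)
    have "AE r in lborel. r \<noteq> r0" by (rule AE_lborel_singleton)
    then show "AE r in lborel. ennreal (overlap_density c D k r) * indicator {r0<..} r =
        ennreal (overlap_density c D k r) * indicator {r0..D + norm c} r"
      by eventually_elim (auto simp: overlap_density_def indicator_def)
  qed
  also have "\<dots> = ennreal ((1 - ?F r0 / ?A) ^ k)"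
    by (rule nn_integral_has_integral_lebesgue'[OF _ int]) (rule overlap_density_nonneg[OF c D])
  finally show ?thesis .
next
  case False
  then have "(\<integral>\<^sup>+r. ennreal (overlap_density c D k r) * indicator {r0<..} r \<partial>lborel) = (\<integral>\<^sup>+r. 0 \<partial>(lborel :: real measure))"
    by (intro nn_integral_cong) (auto simp: overlap_density_def indicator_def)
  with False show ?thesis using D k by (simp add: disk_overlap_outer)
qed

section \<open>The hit probability\<close>

text \<open>Two finite measures on the line are compared on rays: the distance restricted to the
  given counts, whose rays are void probabilities from \<open>joint_law_counts\<close>, and a
  multiple of \<open>overlap_density\<close>.\<close>

lemma nearest_distance_law:
  assumes ps: "prob_space \<Omega>" and P: "poisson_process \<Omega> lam (cball c D) \<Phi>"
    and caching: "independent_caching \<Omega> p \<Phi> \<Phi>'" and p: "0 \<le> p" "p \<le> 1"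
    and lam: "0 < lam" and D: "0 < D" and c: "norm c \<le> D"
    and k: "1 \<le> k" "k \<le> n" and \<psi>: "\<psi> \<in> borel_measurable borel"
  shows "(\<integral>\<^sup>+\<omega>. indicator {\<omega>. card (\<Phi> \<omega>) = n \<and> card (\<Phi>' \<omega>) = k} \<omega> * \<psi> (nearest_distance (\<Phi>' \<omega>)) \<partial>\<Omega>) =
    ennreal (count_weight (lam * pi * D\<^sup>2) p n k) * (\<integral>\<^sup>+r. ennreal (overlap_density c D k r) * \<psi> r \<partial>lborel)"
proof -
  interpret prob_space \<Omega> by fact
  note \<Phi> = poisson_process_config[OF P]
  have \<Phi>'[measurable]: "\<Phi>' \<in> measurable \<Omega> config"
    and \<Phi>'_sub: "\<And>\<omega>. \<omega> \<in> space \<Omega> \<Longrightarrow> \<Phi>' \<omega> \<subseteq> \<Phi> \<omega>"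
    using caching by (auto simp: independent_caching_def)
  have [measurable]: "(\<lambda>\<omega>. nearest_distance (\<Phi>' \<omega>)) \<in> borel_measurable \<Omega>"
    by (rule measurable_compose[OF \<Phi>' measurable_nearest_distance])
  have [measurable]: "overlap_density c D k \<in> borel_measurable borel"
    by (rule borel_measurable_overlap_density[OF c D])
  note [measurable] = \<psi>
  let ?w = "count_weight (lam * pi * D\<^sup>2) p n k"
  have w: "0 \<le> ?w" using p lam by (simp add: count_weight_def)
  let ?H = "{\<omega> \<in> space \<Omega>. card (\<Phi> \<omega>) = n \<and> card (\<Phi>' \<omega>) = k}"
  have Int_W: "\<Phi> \<omega> \<inter> cball c D = \<Phi> \<omega>" "\<Phi>' \<omega> \<inter> cball c D = \<Phi>' \<omega>" if "\<omega> \<in> space \<Omega>" for \<omega>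
    using \<Phi>(3)[OF that] \<Phi>'_sub[OF that] by (auto simp: Int_absorb2)
  have H[measurable]: "?H \<in> events"
  proof -
    have m: "(\<lambda>S. card (S \<inter> cball c D)) \<in> measurable config (count_space UNIV)"
      by (rule measurable_config_count) auto
    have [measurable]: "(\<lambda>\<omega>. card (\<Phi> \<omega> \<inter> cball c D)) \<in> measurable \<Omega> (count_space UNIV)"
      "(\<lambda>\<omega>. card (\<Phi>' \<omega> \<inter> cball c D)) \<in> measurable \<Omega> (count_space UNIV)"
      by (rule measurable_compose[OF \<Phi>(1) m] measurable_compose[OF \<Phi>' m])+
    have "?H = {\<omega> \<in> space \<Omega>. card (\<Phi> \<omega> \<inter> cball c D) = n \<and> card (\<Phi>' \<omega> \<inter> cball c D) = k}"
      using Int_W by auto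
    also have "\<dots> \<in> events" by measurable
    finally show ?thesis .
  qed
  let ?N = "distr (density \<Omega> (indicator ?H)) borel (\<lambda>\<omega>. nearest_distance (\<Phi>' \<omega>))"
  let ?L = "density lborel (\<lambda>r. ennreal ?w * ennreal (overlap_density c D k r))"
  have N: "emeasure ?N {t<..} = prob {\<omega> \<in> space \<Omega>. card (\<Phi> \<omega>) = n \<and> card (\<Phi>' \<omega>) = k \<and> t < nearest_distance (\<Phi>' \<omega>)}" for t
  proof -
    have "emeasure ?N {t<..} = emeasure \<Omega> (?H \<inter> ((\<lambda>\<omega>. nearest_distance (\<Phi>' \<omega>)) -` {t<..} \<inter> space \<Omega>))"
      by (simp add: emeasure_distr emeasure_restricted)
    also have "?H \<inter> ((\<lambda>\<omega>. nearest_distance (\<Phi>' \<omega>)) -` {t<..} \<inter> space \<Omega>) =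
        {\<omega> \<in> space \<Omega>. card (\<Phi> \<omega>) = n \<and> card (\<Phi>' \<omega>) = k \<and> t < nearest_distance (\<Phi>' \<omega>)}"
      by auto
    finally show ?thesis by (simp add: emeasure_eq_measure)
  qed
  have L: "emeasure ?L {t<..} = ennreal ?w * (\<integral>\<^sup>+r. ennreal (overlap_density c D k r) * indicator {t<..} r \<partial>lborel)" for t
    by (simp add: emeasure_density nn_integral_cmult mult.assoc)
  have eq: "?N = ?L"
  proof (rule measure_eqI_lessThan)
    fix t :: real
    show "emeasure ?N {t<..} < \<infinity>" unfolding N by simp
    show "emeasure ?N {t<..} = emeasure ?L {t<..}"
    proof (cases "t < 0")
      case True
      \<comment> \<open>A ray starting below zero carries the whole mass, which corresponds to the
        empty test set.\<close>
      have "{\<omega> \<in> space \<Omega>. card (\<Phi> \<omega>) = n \<and> card (\<Phi>' \<omega>) = k \<and> t < nearest_distance (\<Phi>' \<omega>)} =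
          {\<omega> \<in> space \<Omega>. card (\<Phi> \<omega>) = n \<and> card (\<Phi>' \<omega>) = k \<and> card (\<Phi>' \<omega> \<inter> {}) = 0}"
        using True nearest_distance_nonneg less_le_trans by auto
      then have "emeasure ?N {t<..} = ennreal ?w"
        unfolding N using joint_law_counts[OF ps P caching p D _ _ k(2), of "{}"] by simp
      moreover have "(\<integral>\<^sup>+r. ennreal (overlap_density c D k r) * indicator {t<..} r \<partial>lborel) =
          (\<integral>\<^sup>+r. ennreal (overlap_density c D k r) * indicator {0<..} r \<partial>lborel)"
        using True by (intro nn_integral_cong) (auto simp: overlap_density_def indicator_def)
      moreover have "\<dots> = 1"
        using nn_integral_overlap_density[OF c D k(1), of 0] c by (simp add: disk_overlap_inner)
      ultimately show ?thesis unfolding L by simp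
    next
      case False
      then have t: "0 \<le> t" by simp
      have ne: "\<Phi>' \<omega> \<noteq> {}" if "card (\<Phi>' \<omega>) = k" for \<omega> using that k by auto
      have "\<Phi>' \<omega> \<in> config_space" if "\<omega> \<in> space \<Omega>" for \<omega>
        using measurable_space[OF \<Phi>' that] by simp
      then have "{\<omega> \<in> space \<Omega>. card (\<Phi> \<omega>) = n \<and> card (\<Phi>' \<omega>) = k \<and> t < nearest_distance (\<Phi>' \<omega>)} =
          {\<omega> \<in> space \<Omega>. card (\<Phi> \<omega>) = n \<and> card (\<Phi>' \<omega>) = k \<and> card (\<Phi>' \<omega> \<inter> cball 0 t) = 0}"
        using nearest_distance_gt_iff ne by blast
      then have "emeasure ?N {t<..} = ennreal (?w * (1 - disk_overlap c D t / (pi * D\<^sup>2)) ^ k)"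
        unfolding N using joint_law_counts[OF ps P caching p D _ _ k(2), of "cball 0 t"]
        by (simp add: disk_overlap_def)
      also have "\<dots> = emeasure ?L {t<..}"
        unfolding L nn_integral_overlap_density[OF c D k(1) t] using w by (simp add: ennreal_mult')
      finally show ?thesis .
    qed
  qed simp_all
  have "(\<integral>\<^sup>+\<omega>. indicator {\<omega>. card (\<Phi> \<omega>) = n \<and> card (\<Phi>' \<omega>) = k} \<omega> * \<psi> (nearest_distance (\<Phi>' \<omega>)) \<partial>\<Omega>) =
      (\<integral>\<^sup>+\<omega>. indicator ?H \<omega> * \<psi> (nearest_distance (\<Phi>' \<omega>)) \<partial>\<Omega>)"
    by (rule nn_integral_cong) (simp add: indicator_def)
  also have "\<dots> = (\<integral>\<^sup>+r. \<psi> r \<partial>?N)"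
    by (subst nn_integral_distr) (simp_all add: nn_integral_density)
  also have "\<dots> = (\<integral>\<^sup>+r. ennreal ?w * (ennreal (overlap_density c D k r) * \<psi> r) \<partial>lborel)"
    unfolding eq by (simp add: nn_integral_density mult.assoc)
  also have "\<dots> = ennreal ?w * (\<integral>\<^sup>+r. ennreal (overlap_density c D k r) * \<psi> r \<partial>lborel)"
    by (rule nn_integral_cmult) measurable
  finally show ?thesis .
qed

text \<open>The boundary cases follow from conventions: infinite interference gives quotient
  \<open>0\<close>; \<open>0 powr (- a) = 0\<close> leaves no signal at \<open>r = 0\<close>;
  \<open>ennreal\<close> truncates a negative signal to \<open>0\<close>; a zero denominator gives
  \<open>\<infinity>\<close> when the signal is positive.\<close>

lemma SINR_condition:
  fixes i :: ennreal and P \<beta> \<sigma>2 g r a :: real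
  assumes P: "0 < P" and \<beta>: "0 < \<beta>" and \<sigma>: "0 \<le> \<sigma>2" and r: "0 \<le> r"
  shows "ennreal \<beta> < ennreal (P * g * r powr (- a)) / (ennreal \<sigma>2 + i) \<longleftrightarrow>
    0 < r \<and> i \<noteq> \<infinity> \<and> \<beta> * r powr a * (\<sigma>2 + enn2real i) / P < g"
proof (cases "i = \<infinity> \<or> r = 0")
  case True
  then show ?thesis by (auto simp: ennreal_divide_top)
next
  case False
  then obtain j where i: "i = ennreal j" and j: "0 \<le> j" by (cases i) auto
  have r0: "0 < r" using False r by auto
  define h where "h = P * g * r powr (- a)"
  have thr: "\<beta> * r powr a * (\<sigma>2 + j) / P < g \<longleftrightarrow> \<beta> * (\<sigma>2 + j) < h"
    unfolding h_def powr_minus using P r0 by (simp add: field_simps)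
  have s: "ennreal \<sigma>2 + i = ennreal (\<sigma>2 + j)" using i j \<sigma> by simp
  have "ennreal \<beta> < ennreal h / ennreal (\<sigma>2 + j) \<longleftrightarrow> \<beta> * (\<sigma>2 + j) < h"
  proof (cases "h \<le> 0")
    case True
    then have "ennreal h = 0" by (simp add: ennreal_neg)
    moreover have "0 \<le> \<beta> * (\<sigma>2 + j)" using \<beta> \<sigma> j by simp
    ultimately show ?thesis using True by simp
  next
    case h: False
    show ?thesis
    proof (cases "\<sigma>2 + j = 0")
      case True
      then show ?thesis using h by (simp add: ennreal_divide_zero)
    next
      case F: False
      then have "0 < \<sigma>2 + j" using \<sigma> j by auto
      then show ?thesis
        using h \<beta> by (simp add: divide_ennreal ennreal_less_iff pos_less_divide_eq)
    qed
  qed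
  then show ?thesis using s thr False r0 i j by (simp add: h_def)
qed

abbreviation Q_integrand ::
  "real \<Rightarrow> real \<Rightarrow> real \<Rightarrow> real \<Rightarrow> (real \<Rightarrow> real) \<Rightarrow> nat \<Rightarrow> real \<Rightarrow> real" where
  "Q_integrand P \<beta> \<alpha> \<sigma>2 L j r \<equiv>
     (\<Sum>m\<in>{0..j}. \<beta> ^ m * r powr (\<alpha> * real m) / (P ^ m * fact m) * (-1) ^ m *
        (deriv ^^ m) (\<lambda>s. exp (- s * \<sigma>2) * L s) (\<beta> * r powr \<alpha> / P))"

text \<open>The \<open>m\<close>-th derivative brings down \<open>(- Y) ^ m\<close>, and the factor
  \<open>(-1) ^ m\<close> cancels its sign. Since \<open>r\<close> is positive, the derivatives are
  taken at a positive argument, where differentiation under the integral is justified. The second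
  claim is visible only from this form as an expectation.\<close>

lemma Q_integrand_eq:
  fixes I :: "'w \<Rightarrow> ennreal"
  assumes ps: "prob_space \<Omega>" and I[measurable]: "I \<in> borel_measurable \<Omega>"
    and P: "0 < P" and \<beta>: "0 < \<beta>" and \<sigma>: "0 \<le> \<sigma>2" and r: "0 < r"
  shows "(\<integral>\<^sup>+\<omega>. indicator {\<omega>. I \<omega> \<noteq> \<infinity>} \<omega> *
      ennreal (erlang_tail j (\<beta> * r powr \<alpha> * (\<sigma>2 + enn2real (I \<omega>)) / P)) \<partial>\<Omega>) =
    ennreal (Q_integrand P \<beta> \<alpha> \<sigma>2 (laplace_transform \<Omega> I) j r)"
    and "0 \<le> Q_integrand P \<beta> \<alpha> \<sigma>2 (laplace_transform \<Omega> I) j r"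
proof -
  interpret prob_space \<Omega> by fact
  define s where "s = \<beta> * r powr \<alpha> / P"
  have s: "0 < s" using P \<beta> r by (simp add: s_def)
  define Y where "Y \<omega> = \<sigma>2 + enn2real (I \<omega>)" for \<omega>
  have Y[measurable]: "Y \<in> borel_measurable \<Omega>" unfolding Y_def by measurable
  have Y0: "0 \<le> Y \<omega>" for \<omega> using \<sigma> by (simp add: Y_def)
  \<comment> \<open>Cutting out infinite interference matches the convention in
    \<open>laplace_transform\<close>; \<open>enn2real\<close> alone would read it as
    \<open>0\<close>.\<close>
  define B where "B = {\<omega> \<in> space \<Omega>. I \<omega> \<noteq> \<infinity>}"
  have B[measurable]: "B \<in> events" unfolding B_def by measurable
  let ?G = "\<lambda>s. exp (- s * \<sigma>2) * laplace_transform \<Omega> I s"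
  have G: "?G s = (\<integral>\<omega>. indicator B \<omega> * exp (- s * Y \<omega>) \<partial>\<Omega>)" for s
  proof -
    have "?G s = (\<integral>\<omega>. exp (- s * \<sigma>2) * (if I \<omega> = \<infinity> then 0 else exp (- s * enn2real (I \<omega>))) \<partial>\<Omega>)"
      unfolding laplace_transform_def by simp
    also have "\<dots> = (\<integral>\<omega>. indicator B \<omega> * exp (- s * Y \<omega>) \<partial>\<Omega>)"
      by (rule Bochner_Integration.integral_cong[OF refl])
        (auto simp: B_def Y_def algebra_simps simp flip: exp_add)
    finally show ?thesis .
  qed
  let ?f = "\<lambda>m \<omega>. indicator B \<omega> * ((- Y \<omega>) ^ m * exp (- s * Y \<omega>))"
  have int: "integrable \<Omega> (?f m)" for m
    by (rule integrable_power_times_exp[OF Y B Y0 s])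
  let ?h = "\<lambda>\<omega>. indicator B \<omega> * erlang_tail j (s * Y \<omega>)"
  have summand: "s ^ m / fact m * (-1) ^ m * ?f m \<omega> = indicator B \<omega> * ((s * Y \<omega>) ^ m / fact m * exp (- (s * Y \<omega>)))" for m \<omega>
  proof -
    have "(-1) ^ m * (- Y \<omega>) ^ m = Y \<omega> ^ m"
      by (simp flip: power_mult_distrib)
    then have "s ^ m / fact m * indicator B \<omega> * exp (- (s * Y \<omega>)) * ((-1) ^ m * (- Y \<omega>) ^ m) =
        s ^ m / fact m * indicator B \<omega> * exp (- (s * Y \<omega>)) * Y \<omega> ^ m" by (simp only:)
    then show ?thesis by (simp add: power_mult_distrib mult_ac)
  qed
  have h: "?h = (\<lambda>\<omega>. \<Sum>m\<in>{0..j}. s ^ m / fact m * (-1) ^ m * ?f m \<omega>)"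
    unfolding summand sum_distrib_left ..
  have int_h: "integrable \<Omega> ?h"
    unfolding h by (intro Bochner_Integration.integrable_sum integrable_mult_right int)
  have h0: "0 \<le> ?h \<omega>" for \<omega>
    using s Y0[of \<omega>] by (intro mult_nonneg_nonneg erlang_tail_nonneg) auto
  have coeff: "\<beta> ^ m * r powr (\<alpha> * real m) / (P ^ m * fact m) = s ^ m / fact m" for m
  proof -
    have "(r powr \<alpha>) ^ m = r powr (\<alpha> * real m)"
      using r by (simp add: powr_power mult.commute)
    then show ?thesis by (simp add: s_def power_mult_distrib power_divide)
  qed
  have S: "Q_integrand P \<beta> \<alpha> \<sigma>2 (laplace_transform \<Omega> I) j r = (\<integral>\<omega>. ?h \<omega> \<partial>\<Omega>)"
  proof -
    have "Q_integrand P \<beta> \<alpha> \<sigma>2 (laplace_transform \<Omega> I) j r =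
        (\<Sum>m\<in>{0..j}. s ^ m / fact m * (-1) ^ m * (\<integral>\<omega>. ?f m \<omega> \<partial>\<Omega>))"
      unfolding coeff s_def[symmetric]
      by (intro sum.cong refl arg_cong2[where f="(*)"] higher_deriv_laplace[OF Y Y0 B G s])
    also have "\<dots> = (\<Sum>m\<in>{0..j}. \<integral>\<omega>. s ^ m / fact m * (-1) ^ m * ?f m \<omega> \<partial>\<Omega>)"
      by (simp only: integral_mult_right_zero)
    also have "\<dots> = (\<integral>\<omega>. ?h \<omega> \<partial>\<Omega>)"
      unfolding h
      by (rule Bochner_Integration.integral_sum[symmetric]) (intro integrable_mult_right int)
    finally show ?thesis .
  qed
  then show "0 \<le> Q_integrand P \<beta> \<alpha> \<sigma>2 (laplace_transform \<Omega> I) j r"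
    using h0 by (simp only:) (rule Bochner_Integration.integral_nonneg, rule h0)
  have "(\<integral>\<^sup>+\<omega>. indicator {\<omega>. I \<omega> \<noteq> \<infinity>} \<omega> *
      ennreal (erlang_tail j (\<beta> * r powr \<alpha> * (\<sigma>2 + enn2real (I \<omega>)) / P)) \<partial>\<Omega>) = (\<integral>\<^sup>+\<omega>. ennreal (?h \<omega>) \<partial>\<Omega>)"
  proof (rule nn_integral_cong)
    fix \<omega> assume "\<omega> \<in> space \<Omega>"
    moreover have "\<beta> * r powr \<alpha> * (\<sigma>2 + enn2real (I \<omega>)) / P = s * Y \<omega>"
      by (simp add: s_def Y_def)
    ultimately show "indicator {\<omega>. I \<omega> \<noteq> \<infinity>} \<omega> *
      ennreal (erlang_tail j (\<beta> * r powr \<alpha> * (\<sigma>2 + enn2real (I \<omega>)) / P)) = ennreal (?h \<omega>)"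
      by (simp only:) (simp add: B_def indicator_def)
  qed
  also have "\<dots> = ennreal (\<integral>\<omega>. ?h \<omega> \<partial>\<Omega>)"
    by (rule nn_integral_eq_integral[OF int_h]) (use h0 in auto)
  finally show "(\<integral>\<^sup>+\<omega>. indicator {\<omega>. I \<omega> \<noteq> \<infinity>} \<omega> *
      ennreal (erlang_tail j (\<beta> * r powr \<alpha> * (\<sigma>2 + enn2real (I \<omega>)) / P)) \<partial>\<Omega>) =
    ennreal (Q_integrand P \<beta> \<alpha> \<sigma>2 (laplace_transform \<Omega> I) j r)"
    unfolding S .
qed

text \<open>The integrands can differ only at \<open>0\<close> and \<open>D - norm c\<close>, a null
  set on which the values of \<open>deriv\<close> are not controlled.\<close>

lemma Q_eq_overlap_integral:
  assumes c: "norm c \<le> D" and D: "0 < D"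
    and \<psi>: "\<And>r. 0 < r \<Longrightarrow> \<psi> r = Q_integrand P \<beta> \<alpha> \<sigma>2 L (M - l) r"
  shows "Q M P \<beta> \<alpha> \<sigma>2 L D (norm c) l k = (\<integral>r. overlap_density c D k r * \<psi> r \<partial>lborel)"
  unfolding Q_def set_lebesgue_integral_def
proof (rule integral_discrete_difference[where X="{0, D - norm c}"])
  fix r :: real assume r: "r \<notin> {0, D - norm c}"
  then have "overlap_density c D k r = indicator {0..D + norm c} r * distance_density D (norm c) k r"
    by (intro overlap_density_eq[OF c D]) auto
  then show "indicat_real {0..D + norm c} r *\<^sub>R
      (Q_integrand P \<beta> \<alpha> \<sigma>2 L (M - l) r * distance_density D (norm c) k r) = overlap_density c D k r * \<psi> r"
    using r \<psi>[of r] by (cases "r \<in> {0..D + norm c}") auto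
qed auto

text \<open>The three sources of randomness are integrated out in turn: the gain by its Erlang law,
  the interference by independence, the position by the law of the nearest distance. Measurability
  and the sign of \<open>Q\<close> are kept for the summation over the counts.\<close>

lemma hit_probability_given_counts:
  fixes g :: "'w \<Rightarrow> real" and I :: "'w \<Rightarrow> ennreal"
  assumes ps: "prob_space \<Omega>" and PP: "poisson_process \<Omega> lam (cball c D) \<Phi>"
    and caching: "independent_caching \<Omega> p \<Phi> \<Phi>'" and p: "0 \<le> p" "p \<le> 1"
    and lam: "0 < lam" and D: "0 < D" and c: "norm c \<le> D"
    and P: "0 < P" and \<beta>: "0 < \<beta>" and \<sigma>: "0 \<le> \<sigma>2" and M: "1 \<le> M"
    and ind: "indep_elements \<Omega> (config \<Otimes>\<^sub>M config) (\<lambda>\<omega>. (\<Phi> \<omega>, \<Phi>' \<omega>)) borel I"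
    and gain: "serving_gain \<Omega> M \<Phi> \<Phi>' I g"
    and k: "1 \<le> k" "k \<le> n"
  shows "measure \<Omega> {\<omega> \<in> space \<Omega>. card (\<Phi> \<omega>) = n \<and> card (\<Phi>' \<omega>) = k \<and>
        SINR P \<alpha> \<sigma>2 \<Phi>' g I \<omega> > ennreal \<beta>} =
      count_weight (lam * pi * D\<^sup>2) p n k * Q M P \<beta> \<alpha> \<sigma>2 (laplace_transform \<Omega> I) D (norm c) (min M n) k"
    and "0 \<le> Q M P \<beta> \<alpha> \<sigma>2 (laplace_transform \<Omega> I) D (norm c) (min M n) k"
    and "{\<omega> \<in> space \<Omega>. card (\<Phi> \<omega>) = n \<and> card (\<Phi>' \<omega>) = k \<and>
        SINR P \<alpha> \<sigma>2 \<Phi>' g I \<omega> > ennreal \<beta>} \<in> sets \<Omega>"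
proof -
  interpret prob_space \<Omega> by fact
  note \<Phi> = poisson_process_config[OF PP]
  note [measurable] = \<Phi>(1)
  have \<Phi>'[measurable]: "\<Phi>' \<in> measurable \<Omega> config"
    and \<Phi>'_sub: "\<And>\<omega>. \<omega> \<in> space \<Omega> \<Longrightarrow> \<Phi>' \<omega> \<subseteq> \<Phi> \<omega>"
    using caching by (auto simp: independent_caching_def)
  have I[measurable]: "I \<in> borel_measurable \<Omega>" using ind by (simp add: indep_elements_def)
  have g[measurable]: "g \<in> borel_measurable \<Omega>" using gain by (simp add: serving_gain_def)
  note [measurable] = measurable_nearest_distance
  have [measurable]: "overlap_density c D k \<in> borel_measurable borel"
    by (rule borel_measurable_overlap_density[OF c D])
  have [measurable]: "(\<lambda>S. card (S \<inter> cball c D)) \<in> measurable config (count_space UNIV)"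
    by (rule measurable_config_count) auto
  have Int_W: "\<Phi> \<omega> \<inter> cball c D = \<Phi> \<omega>" "\<Phi>' \<omega> \<inter> cball c D = \<Phi>' \<omega>" if "\<omega> \<in> space \<Omega>" for \<omega>
    using \<Phi>(3)[OF that] \<Phi>'_sub[OF that] by (auto simp: Int_absorb2)
  define l where "l = min M n"
  have l: "l \<in> {1..M}" using M k by (auto simp: l_def)
  let ?S = "config \<Otimes>\<^sub>M config \<Otimes>\<^sub>M (borel :: ennreal measure)"
  let ?W = "\<lambda>\<omega>. (\<Phi> \<omega>, \<Phi>' \<omega>, I \<omega>)"
  let ?tail = "\<lambda>T i. erlang_tail (M - l) (\<beta> * nearest_distance T powr \<alpha> * (\<sigma>2 + enn2real i) / P)"
  define \<tau> where "\<tau> = (\<lambda>(S :: loc set, T, i). \<beta> * nearest_distance T powr \<alpha> * (\<sigma>2 + enn2real i) / P)"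
  \<comment> \<open>\<open>serving_gain\<close> speaks of events of the triple \<open>?W\<close>.
    Encoding counts, positive distance and finite interference as such an event lets it be
    intersected with any further \<open>E\<close>. The counts are taken in \<open>cball c D\<close>
    because measurability is available for bounded sets.\<close>
  define E0 where "E0 = {w \<in> space ?S. card (fst w \<inter> cball c D) = n \<and>
    card (fst (snd w) \<inter> cball c D) = k \<and> 0 < nearest_distance (fst (snd w)) \<and> snd (snd w) \<noteq> \<infinity>}"
  have E0[measurable]: "E0 \<in> sets ?S" unfolding E0_def by measurable
  define H where "H \<omega> \<longleftrightarrow> card (\<Phi> \<omega>) = n \<and> card (\<Phi>' \<omega>) = k \<and>
    0 < nearest_distance (\<Phi>' \<omega>) \<and> I \<omega> \<noteq> \<infinity>" for \<omega>
  have W[measurable]: "?W \<in> measurable \<Omega> ?S" by measurable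
  have H_iff: "H \<omega> \<longleftrightarrow> ?W \<omega> \<in> E0" if "\<omega> \<in> space \<Omega>" for \<omega>
    using Int_W[OF that] measurable_space[OF W that] by (simp add: H_def E0_def)
  have H_meas: "{\<omega> \<in> space \<Omega>. H \<omega>} \<in> events"
  proof -
    have "{\<omega> \<in> space \<Omega>. H \<omega>} = ?W -` E0 \<inter> space \<Omega>" using H_iff by auto
    then show ?thesis by simp
  qed
  have H_serving: "min M (card (\<Phi> \<omega>)) = l" "\<Phi>' \<omega> \<noteq> {}" if "H \<omega>" for \<omega>
    using that k by (auto simp: H_def l_def)
  have tail: "prob {\<omega> \<in> space \<Omega>. H \<omega> \<and> ?W \<omega> \<in> E \<and> t < g \<omega>} =
      erlang_tail (M - l) t * prob {\<omega> \<in> space \<Omega>. H \<omega> \<and> ?W \<omega> \<in> E}" if "0 \<le> t" "E \<in> sets ?S" for t E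
  proof -
    have "E0 \<inter> E \<in> sets ?S" using that by auto
    then have "prob {\<omega> \<in> space \<Omega>. min M (card (\<Phi> \<omega>)) = l \<and> \<Phi>' \<omega> \<noteq> {} \<and> ?W \<omega> \<in> E0 \<inter> E \<and> g \<omega> > t} =
        erlang_tail (M - l) t * prob {\<omega> \<in> space \<Omega>. min M (card (\<Phi> \<omega>)) = l \<and> \<Phi>' \<omega> \<noteq> {} \<and> ?W \<omega> \<in> E0 \<inter> E}"
      using gain l that(1) unfolding serving_gain_def by blast
    moreover have "{\<omega> \<in> space \<Omega>. min M (card (\<Phi> \<omega>)) = l \<and> \<Phi>' \<omega> \<noteq> {} \<and> ?W \<omega> \<in> E0 \<inter> E \<and> g \<omega> > t} =
        {\<omega> \<in> space \<Omega>. H \<omega> \<and> ?W \<omega> \<in> E \<and> t < g \<omega>}"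
      using H_iff H_serving by blast
    moreover have "{\<omega> \<in> space \<Omega>. min M (card (\<Phi> \<omega>)) = l \<and> \<Phi>' \<omega> \<noteq> {} \<and> ?W \<omega> \<in> E0 \<inter> E} =
        {\<omega> \<in> space \<Omega>. H \<omega> \<and> ?W \<omega> \<in> E}"
      using H_iff H_serving by blast
    ultimately show ?thesis by (simp only:)
  qed
  have \<tau>[measurable]: "\<tau> \<in> borel_measurable ?S" unfolding \<tau>_def by measurable
  have \<tau>0: "0 \<le> \<tau> w" for w using P \<beta> \<sigma> by (auto simp: \<tau>_def split: prod.split)
  \<comment> \<open>Hit probability at distance \<open>r\<close> when \<open>l\<close> units are
    active. It is set to \<open>0\<close> at \<open>r = 0\<close>, where no hit occurs.\<close>
  define \<psi> where "\<psi> r = indicator {0<..} r * (\<integral>\<^sup>+\<omega>. indicator {\<omega>. I \<omega> \<noteq> \<infinity>} \<omega> *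
      ennreal (erlang_tail (M - l) (\<beta> * r powr \<alpha> * (\<sigma>2 + enn2real (I \<omega>)) / P)) \<partial>\<Omega>)" for r
  have ind_I: "(\<lambda>\<omega>. indicator {\<omega>. I \<omega> \<noteq> \<infinity>} \<omega> :: ennreal) = (\<lambda>\<omega>. indicator {i. i \<noteq> \<infinity>} (I \<omega>))"
    by (simp add: fun_eq_iff indicator_def)
  have \<psi>[measurable]: "\<psi> \<in> borel_measurable borel"
    unfolding \<psi>_def ind_I by measurable
  let ?L = "laplace_transform \<Omega> I"
  have \<psi>_eq: "\<psi> r = ennreal (Q_integrand P \<beta> \<alpha> \<sigma>2 ?L (M - l) r)" if "0 < r" for r
    using Q_integrand_eq(1)[OF ps I P \<beta> \<sigma> that, where j="M - l" and \<alpha>=\<alpha>] that by (simp add: \<psi>_def)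
  have \<psi>_real: "\<psi> r = ennreal (enn2real (\<psi> r))" for r
  proof (cases "0 < r")
    case True
    then show ?thesis using \<psi>_eq[OF True] by simp
  qed (simp add: \<psi>_def)
  have Q: "Q M P \<beta> \<alpha> \<sigma>2 ?L D (norm c) l k = (\<integral>r. overlap_density c D k r * enn2real (\<psi> r) \<partial>lborel)"
    using \<psi>_eq Q_integrand_eq(2)[OF ps I P \<beta> \<sigma>]
    by (intro Q_eq_overlap_integral[OF c D]) simp
  have nonneg: "0 \<le> overlap_density c D k r * enn2real (\<psi> r)" for r
    using overlap_density_nonneg[OF c D] by simp
  then show "0 \<le> Q M P \<beta> \<alpha> \<sigma>2 ?L D (norm c) (min M n) k"
    unfolding l_def[symmetric] Q by (intro Bochner_Integration.integral_nonneg) auto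
  have hit: "{\<omega> \<in> space \<Omega>. card (\<Phi> \<omega>) = n \<and> card (\<Phi>' \<omega>) = k \<and> SINR P \<alpha> \<sigma>2 \<Phi>' g I \<omega> > ennreal \<beta>} =
      {\<omega> \<in> space \<Omega>. H \<omega> \<and> \<tau> (?W \<omega>) < g \<omega>}"
  proof -
    have "SINR P \<alpha> \<sigma>2 \<Phi>' g I \<omega> > ennreal \<beta> \<longleftrightarrow>
        0 < nearest_distance (\<Phi>' \<omega>) \<and> I \<omega> \<noteq> \<infinity> \<and> \<tau> (?W \<omega>) < g \<omega>" if "card (\<Phi>' \<omega>) = k" for \<omega>
    proof -
      have ne: "\<Phi>' \<omega> \<noteq> {}" using that k by auto
      then have "SINR P \<alpha> \<sigma>2 \<Phi>' g I \<omega> =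
          ennreal (P * g \<omega> * nearest_distance (\<Phi>' \<omega>) powr (- \<alpha>)) / (ennreal \<sigma>2 + I \<omega>)"
        by (simp add: SINR_def nearest_distance_def)
      then show ?thesis
        using SINR_condition[OF P \<beta> \<sigma> nearest_distance_nonneg] by (simp add: \<tau>_def)
    qed
    then show ?thesis by (auto simp: H_def)
  qed
  have "{\<omega> \<in> space \<Omega>. H \<omega> \<and> \<tau> (?W \<omega>) < g \<omega>} = {\<omega> \<in> space \<Omega>. H \<omega>} \<inter> {\<omega> \<in> space \<Omega>. \<tau> (?W \<omega>) < g \<omega>}"
    by auto
  also have "\<dots> \<in> events"
    using H_meas by (rule sets.Int) measurable
  finally show "{\<omega> \<in> space \<Omega>. card (\<Phi> \<omega>) = n \<and> card (\<Phi>' \<omega>) = k \<and>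
      SINR P \<alpha> \<sigma>2 \<Phi>' g I \<omega> > ennreal \<beta>} \<in> events"
    unfolding hit .
  have "emeasure \<Omega> {\<omega> \<in> space \<Omega>. card (\<Phi> \<omega>) = n \<and> card (\<Phi>' \<omega>) = k \<and> SINR P \<alpha> \<sigma>2 \<Phi>' g I \<omega> > ennreal \<beta>} =
      (\<integral>\<^sup>+\<omega>. indicator {\<omega>. H \<omega>} \<omega> * ennreal (erlang_tail (M - l) (\<tau> (?W \<omega>))) \<partial>\<Omega>)"
    unfolding hit by (rule emeasure_exceeds_random_threshold[OF ps W g H_meas tail \<tau> \<tau>0])
  \<comment> \<open>Regrouped as one function of the pair of configurations and of the interference,
    the form to which independence applies.\<close>
  also have "\<dots> = (\<integral>\<^sup>+\<omega>. indicator {w. card (fst w \<inter> cball c D) = n \<and> card (snd w \<inter> cball c D) = k \<and>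
        0 < nearest_distance (snd w)} (\<Phi> \<omega>, \<Phi>' \<omega>) *
      (indicator {i. i \<noteq> \<infinity>} (I \<omega>) * ennreal (?tail (\<Phi>' \<omega>) (I \<omega>))) \<partial>\<Omega>)"
    by (rule nn_integral_cong) (auto simp: H_def \<tau>_def Int_W indicator_def)
  also have "\<dots> = (\<integral>\<^sup>+\<omega>. (\<integral>\<^sup>+\<omega>'. indicator {w. card (fst w \<inter> cball c D) = n \<and> card (snd w \<inter> cball c D) = k \<and>
        0 < nearest_distance (snd w)} (\<Phi> \<omega>, \<Phi>' \<omega>) *
      (indicator {i. i \<noteq> \<infinity>} (I \<omega>') * ennreal (?tail (\<Phi>' \<omega>) (I \<omega>'))) \<partial>\<Omega>) \<partial>\<Omega>)"
  proof -
    have "(\<lambda>(w, i). indicator {w. card (fst w \<inter> cball c D) = n \<and> card (snd w \<inter> cball c D) = k \<and>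
        0 < nearest_distance (snd w)} w * (indicator {i. i \<noteq> \<infinity>} i * ennreal (?tail (snd w) i)))
      \<in> borel_measurable ((config \<Otimes>\<^sub>M config) \<Otimes>\<^sub>M borel)"
      by measurable
    from nn_integral_indep_elements[OF ps ind this] show ?thesis by simp
  qed
  also have "\<dots> = (\<integral>\<^sup>+\<omega>. indicator {\<omega>. card (\<Phi> \<omega>) = n \<and> card (\<Phi>' \<omega>) = k} \<omega> * \<psi> (nearest_distance (\<Phi>' \<omega>)) \<partial>\<Omega>)"
  proof (rule nn_integral_cong)
    fix \<omega> assume \<omega>: "\<omega> \<in> space \<Omega>"
    define J where "J = (\<integral>\<^sup>+\<omega>'. indicator {i. i \<noteq> \<infinity>} (I \<omega>') * ennreal (?tail (\<Phi>' \<omega>) (I \<omega>')) \<partial>\<Omega>)"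
    have 1: "(\<integral>\<^sup>+\<omega>'. indicator {w. card (fst w \<inter> cball c D) = n \<and> card (snd w \<inter> cball c D) = k \<and>
        0 < nearest_distance (snd w)} (\<Phi> \<omega>, \<Phi>' \<omega>) *
      (indicator {i. i \<noteq> \<infinity>} (I \<omega>') * ennreal (?tail (\<Phi>' \<omega>) (I \<omega>'))) \<partial>\<Omega>) =
      indicator {w. card (fst w \<inter> cball c D) = n \<and> card (snd w \<inter> cball c D) = k \<and>
        0 < nearest_distance (snd w)} (\<Phi> \<omega>, \<Phi>' \<omega>) *
      J"
      unfolding J_def by (rule nn_integral_cmult) measurable
    have 2: "\<psi> (nearest_distance (\<Phi>' \<omega>)) = indicator {0<..} (nearest_distance (\<Phi>' \<omega>)) * J"
      unfolding \<psi>_def ind_I J_def ..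
    show "(\<integral>\<^sup>+\<omega>'. indicator {w. card (fst w \<inter> cball c D) = n \<and> card (snd w \<inter> cball c D) = k \<and>
        0 < nearest_distance (snd w)} (\<Phi> \<omega>, \<Phi>' \<omega>) *
      (indicator {i. i \<noteq> \<infinity>} (I \<omega>') * ennreal (?tail (\<Phi>' \<omega>) (I \<omega>'))) \<partial>\<Omega>) =
      indicator {\<omega>. card (\<Phi> \<omega>) = n \<and> card (\<Phi>' \<omega>) = k} \<omega> * \<psi> (nearest_distance (\<Phi>' \<omega>))"
      unfolding 1 2 using Int_W[OF \<omega>] by (auto simp: indicator_def)
  qed
  also have "\<dots> = ennreal (count_weight (lam * pi * D\<^sup>2) p n k) * (\<integral>\<^sup>+r. ennreal (overlap_density c D k r) * \<psi> r \<partial>lborel)"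
    by (rule nearest_distance_law[OF ps PP caching p lam D c k \<psi>])
  also have "(\<integral>\<^sup>+r. ennreal (overlap_density c D k r) * \<psi> r \<partial>lborel) =
      (\<integral>\<^sup>+r. ennreal (overlap_density c D k r * enn2real (\<psi> r)) \<partial>lborel)"
    by (rule nn_integral_cong, subst \<psi>_real) (simp add: ennreal_mult overlap_density_nonneg[OF c D])
  finally have "prob {\<omega> \<in> space \<Omega>. card (\<Phi> \<omega>) = n \<and> card (\<Phi>' \<omega>) = k \<and> SINR P \<alpha> \<sigma>2 \<Phi>' g I \<omega> > ennreal \<beta>} =
      count_weight (lam * pi * D\<^sup>2) p n k *
      enn2real (\<integral>\<^sup>+r. ennreal (overlap_density c D k r * enn2real (\<psi> r)) \<partial>lborel)"
    using p lam by (simp add: measure_def enn2real_mult count_weight_def)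
  also have "enn2real (\<integral>\<^sup>+r. ennreal (overlap_density c D k r * enn2real (\<psi> r)) \<partial>lborel) =
      (\<integral>r. overlap_density c D k r * enn2real (\<psi> r) \<partial>lborel)"
    by (rule integral_eq_nn_integral[symmetric]) (use nonneg in auto)
  finally show "prob {\<omega> \<in> space \<Omega>. card (\<Phi> \<omega>) = n \<and> card (\<Phi>' \<omega>) = k \<and> SINR P \<alpha> \<sigma>2 \<Phi>' g I \<omega> > ennreal \<beta>} =
      count_weight (lam * pi * D\<^sup>2) p n k * Q M P \<beta> \<alpha> \<sigma>2 ?L D (norm c) (min M n) k"
    unfolding l_def[symmetric] Q .
qed

section \<open>Summation over the counts\<close>

text \<open>Splitting a Poisson number: caching and other units have independent Poisson numbers of
  means \<open>\<mu> * p\<close> and \<open>\<mu> * (1 - p)\<close>. For fixed \<open>k\<close> the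
  sum over \<open>t\<close> can therefore be evaluated.\<close>

lemma count_weight_split:
  "count_weight \<mu> p (k + t) k =
    exp (- (\<mu> * p)) * (\<mu> * p) ^ k / fact k * (exp (- (\<mu> * (1 - p))) * (\<mu> * (1 - p)) ^ t / fact t)"
proof -
  have "exp (- \<mu>) = exp (- (\<mu> * p)) * exp (- (\<mu> * (1 - p)))"
    by (simp add: algebra_simps flip: exp_add)
  then show ?thesis
    by (simp add: count_weight_def power_add power_mult_distrib)
qed

lemma poisson_weights_sums: "(\<lambda>t. exp (- \<nu>) * \<nu> ^ t / fact t) sums (1 :: real)"
proof -
  have "(\<lambda>t. exp (- \<nu>) * (\<nu> ^ t / fact t)) sums (exp (- \<nu>) * exp \<nu>)"
    using exp_converges[of \<nu>] by (intro sums_mult) (simp add: divide_inverse mult.commute)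
  then show ?thesis by (simp flip: exp_add)
qed

text \<open>
  The weights of all \<open>t\<close> sum to a Poisson probability; splitting off \<open>q M\<close> leaves a finite sum.
\<close>

lemma sums_count_mixture:
  fixes q :: "nat \<Rightarrow> real"
  shows "(\<lambda>t. count_weight \<mu> p (k + t) k * q (min M (k + t))) sums
    ((\<Sum>t\<in>{..<M - k}. q (k + t) * count_weight \<mu> p (k + t) k) +
     q M * (exp (- (\<mu> * p)) * (\<mu> * p) ^ k / fact k) *
       (1 - (\<Sum>t\<in>{..<M - k}. exp (- (\<mu> * (1 - p))) * (\<mu> * (1 - p)) ^ t / fact t)))"
proof -
  define a where "a = exp (- (\<mu> * p)) * (\<mu> * p) ^ k / fact k"
  define b where "b t = exp (- (\<mu> * (1 - p))) * (\<mu> * (1 - p)) ^ t / fact t" for t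
  have w: "count_weight \<mu> p (k + t) k = a * b t" for t
    unfolding a_def b_def by (rule count_weight_split)
  have "(\<lambda>t. if t \<in> {..<M - k} then a * b t * (q (k + t) - q M) else 0) sums
      (\<Sum>t\<in>{..<M - k}. a * b t * (q (k + t) - q M))"
    by (rule sums_If_finite_set) simp
  moreover have "(\<lambda>t. q M * a * b t) sums (q M * a * 1)"
    unfolding b_def by (intro sums_mult poisson_weights_sums)
  ultimately have "(\<lambda>t. (if t \<in> {..<M - k} then a * b t * (q (k + t) - q M) else 0) + q M * a * b t) sums
      ((\<Sum>t\<in>{..<M - k}. a * b t * (q (k + t) - q M)) + q M * a * 1)"
    by (rule sums_add)
  moreover have "(if t \<in> {..<M - k} then a * b t * (q (k + t) - q M) else 0) + q M * a * b t =
      count_weight \<mu> p (k + t) k * q (min M (k + t))" for t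
  proof (cases "t < M - k")
    case True
    then have "min M (k + t) = k + t" by simp
    then show ?thesis using True by (simp add: w algebra_simps)
  next
    case False
    then have "min M (k + t) = M" by simp
    then show ?thesis using False by (simp add: w algebra_simps)
  qed
  moreover have "(\<Sum>t\<in>{..<M - k}. a * b t * (q (k + t) - q M)) + q M * a * 1 =
      (\<Sum>t\<in>{..<M - k}. q (k + t) * count_weight \<mu> p (k + t) k) + q M * a * (1 - (\<Sum>t\<in>{..<M - k}. b t))"
    by (simp add: w right_diff_distrib sum_subtractf sum_distrib_left mult_ac)
  ultimately show ?thesis
    unfolding a_def[symmetric] b_def[symmetric] by simp
qed

text \<open>The range \<open>{..<M - k}\<close> is empty for \<open>k \<ge> M\<close>, whereas
  truncated subtraction would turn \<open>{0..M - 1 - k}\<close> into \<open>{0}\<close>. The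
  \<open>infsum\<close> is a genuine value and not the default for divergent sums: the proof
  establishes \<open>has_sum\<close>.\<close>

theorem mainTheorem5:
  fixes \<Omega> :: "'w measure"
    and lam lam\<^sub>p D P \<beta> \<sigma>2 d\<^sub>g \<alpha>\<^sub>i \<alpha>\<^sub>o p\<^sub>i :: real
    and M :: nat and x\<^sub>o :: loc
    and \<Phi> \<Phi>\<^sub>i :: "'w \<Rightarrow> loc set" and g :: "'w \<Rightarrow> real"
    and X :: "nat \<Rightarrow> 'w \<Rightarrow> loc" and C A :: "nat \<Rightarrow> 'w \<Rightarrow> loc set"
    and y :: "nat \<Rightarrow> nat \<Rightarrow> 'w \<Rightarrow> loc" and f :: "nat \<Rightarrow> nat \<Rightarrow> 'w \<Rightarrow> real"
    and I\<^sub>o :: "'w \<Rightarrow> ennreal" and L :: "real \<Rightarrow> real"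
  assumes "prob_space \<Omega>"
    and "lam > 0" "lam\<^sub>p > 0" "D > 0" "P > 0" "\<beta> > 0"
    and "\<sigma>2 \<ge> 0" "d\<^sub>g \<ge> 0"
    and "0 < \<alpha>\<^sub>i" "\<alpha>\<^sub>i < \<alpha>\<^sub>o"
    and "M \<ge> 1"
    and "0 \<le> p\<^sub>i" "p\<^sub>i \<le> 1"
    and "norm x\<^sub>o \<le> D"
    and representative_cloud: "poisson_process \<Omega> lam (cball x\<^sub>o D) \<Phi>"
    and caching: "independent_caching \<Omega> p\<^sub>i \<Phi> \<Phi>\<^sub>i"
    and other_clouds: "out_of_cloud \<Omega> lam\<^sub>p lam D d\<^sub>g M X C A y f"
    and I\<^sub>o: "I\<^sub>o = interference P \<alpha>\<^sub>o A y f"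
    and interference_indep:
      "indep_elements \<Omega> (config \<Otimes>\<^sub>M config) (\<lambda>\<omega>. (\<Phi> \<omega>, \<Phi>\<^sub>i \<omega>)) borel I\<^sub>o"
    and gain: "serving_gain \<Omega> M \<Phi> \<Phi>\<^sub>i I\<^sub>o g"
    and L: "L = laplace_transform \<Omega> I\<^sub>o"
  shows "hit_probability \<Omega> P \<alpha>\<^sub>i \<sigma>2 \<beta> \<Phi>\<^sub>i g I\<^sub>o =
    (\<Sum>k\<in>{1..M - 1}. \<Sum>t\<in>{..<M - k}.
       Q M P \<beta> \<alpha>\<^sub>i \<sigma>2 L D (norm x\<^sub>o) (k + t) k *
       (exp (- (lam * pi * D\<^sup>2)) * (lam * pi * D\<^sup>2) ^ (k + t) * p\<^sub>i ^ k * (1 - p\<^sub>i) ^ t /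
         (fact k * fact t))) +
    (\<Sum>\<^sub>\<infinity>k\<in>{1..}.
       Q M P \<beta> \<alpha>\<^sub>i \<sigma>2 L D (norm x\<^sub>o) M k *
       (exp (- (lam * p\<^sub>i * pi * D\<^sup>2)) * (lam * p\<^sub>i * pi * D\<^sup>2) ^ k / fact k) *
       (1 - (\<Sum>t\<in>{..<M - k}.
               exp (- (lam * (1 - p\<^sub>i) * pi * D\<^sup>2)) * (lam * (1 - p\<^sub>i) * pi * D\<^sup>2) ^ t / fact t)))"
proof -
  interpret prob_space \<Omega> by fact
  let ?c = "x\<^sub>o" and ?\<mu> = "lam * pi * D\<^sup>2"
  let ?Q = "Q M P \<beta> \<alpha>\<^sub>i \<sigma>2 L D (norm x\<^sub>o)"
  note \<Phi> = poisson_process_config[OF representative_cloud]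
  have \<Phi>\<^sub>i: "\<Phi>\<^sub>i \<in> measurable \<Omega> config"
    and \<Phi>\<^sub>i_sub: "\<And>\<omega>. \<omega> \<in> space \<Omega> \<Longrightarrow> \<Phi>\<^sub>i \<omega> \<subseteq> \<Phi> \<omega>"
    using caching by (auto simp: independent_caching_def)
  have fin: "finite (\<Phi> \<omega>)" if "\<omega> \<in> space \<Omega>" for \<omega>
    using config_space_finite_Int[OF \<Phi>(2)[OF that], of "cball x\<^sub>o D"] \<Phi>(3)[OF that]
    by (simp add: Int_absorb2)
  have fin_i: "finite (\<Phi>\<^sub>i \<omega>)" and card_le: "card (\<Phi>\<^sub>i \<omega>) \<le> card (\<Phi> \<omega>)" if "\<omega> \<in> space \<Omega>" for \<omega>
    using fin[OF that] \<Phi>\<^sub>i_sub[OF that] by (auto intro: finite_subset card_mono)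
  define h where "h \<omega> \<longleftrightarrow> SINR P \<alpha>\<^sub>i \<sigma>2 \<Phi>\<^sub>i g I\<^sub>o \<omega> > ennreal \<beta>" for \<omega>
  \<comment> \<open>A hit with \<open>k\<close> caching units and \<open>t\<close> others; the
    number of active units is then \<open>min M (k + t)\<close>.\<close>
  define A where "A k t = {\<omega> \<in> space \<Omega>. card (\<Phi> \<omega>) = k + t \<and> card (\<Phi>\<^sub>i \<omega>) = k \<and> h \<omega>}" for k t
  have A: "prob (A k t) = count_weight ?\<mu> p\<^sub>i (k + t) k * ?Q (min M (k + t)) k"
    and Q_nonneg: "0 \<le> ?Q (min M (k + t)) k"
    and A_meas: "A k t \<in> events" if "1 \<le> k" for k t
    unfolding A_def h_def L
    using hit_probability_given_counts[OF \<open>prob_space \<Omega>\<close> representative_cloud caching \<open>0 \<le> p\<^sub>i\<close> \<open>p\<^sub>i \<le> 1\<close>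
        \<open>lam > 0\<close> \<open>D > 0\<close> \<open>norm x\<^sub>o \<le> D\<close> \<open>P > 0\<close> \<open>\<beta> > 0\<close> \<open>\<sigma>2 \<ge> 0\<close> \<open>M \<ge> 1\<close> interference_indep gain that, of "k + t"]
    by auto
  define fin_part where "fin_part k = (\<Sum>t\<in>{..<M - k}. ?Q (k + t) k * count_weight ?\<mu> p\<^sub>i (k + t) k)" for k
  define tail_part where "tail_part k = ?Q M k * (exp (- (?\<mu> * p\<^sub>i)) * (?\<mu> * p\<^sub>i) ^ k / fact k) *
       (1 - (\<Sum>t\<in>{..<M - k}. exp (- (?\<mu> * (1 - p\<^sub>i))) * (?\<mu> * (1 - p\<^sub>i)) ^ t / fact t))" for k
  have B: "prob (\<Union>t. A k t) = fin_part k + tail_part k" if k: "1 \<le> k" for k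
  proof -
    have "(\<lambda>t. prob (A k t)) sums prob (\<Union>t. A k t)"
      using A_meas[OF k] by (intro finite_measure_UNION) (auto simp: disjoint_family_on_def A_def)
    then have "(\<lambda>t. count_weight ?\<mu> p\<^sub>i (k + t) k * ?Q (min M (k + t)) k) sums prob (\<Union>t. A k t)"
      by (simp only: A[OF k])
    then show ?thesis
      unfolding fin_part_def tail_part_def by (rule sums_unique2[OF _ sums_count_mixture])
  qed
  have hit: "{\<omega> \<in> space \<Omega>. \<Phi>\<^sub>i \<omega> \<noteq> {} \<and> SINR P \<alpha>\<^sub>i \<sigma>2 \<Phi>\<^sub>i g I\<^sub>o \<omega> > ennreal \<beta>} = (\<Union>k. \<Union>t. A (Suc k) t)"
  proof (intro set_eqI iffI)
    fix \<omega> assume \<omega>: "\<omega> \<in> {\<omega> \<in> space \<Omega>. \<Phi>\<^sub>i \<omega> \<noteq> {} \<and> SINR P \<alpha>\<^sub>i \<sigma>2 \<Phi>\<^sub>i g I\<^sub>o \<omega> > ennreal \<beta>}"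
    then have "0 < card (\<Phi>\<^sub>i \<omega>)" using fin_i by (auto simp: card_gt_0_iff)
    then have "\<omega> \<in> A (Suc (card (\<Phi>\<^sub>i \<omega>) - 1)) (card (\<Phi> \<omega>) - card (\<Phi>\<^sub>i \<omega>))"
      using \<omega> card_le by (auto simp: A_def h_def)
    then show "\<omega> \<in> (\<Union>k. \<Union>t. A (Suc k) t)" by blast
  next
    fix \<omega> assume "\<omega> \<in> (\<Union>k. \<Union>t. A (Suc k) t)"
    then show "\<omega> \<in> {\<omega> \<in> space \<Omega>. \<Phi>\<^sub>i \<omega> \<noteq> {} \<and> SINR P \<alpha>\<^sub>i \<sigma>2 \<Phi>\<^sub>i g I\<^sub>o \<omega> > ennreal \<beta>}"
      by (auto simp: A_def h_def)
  qed
  have "(\<Union>t. A (Suc k) t) \<in> events" for k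
    using A_meas[of "Suc k"] by (intro sets.countable_UN) auto
  then have "(\<lambda>k. prob (\<Union>t. A (Suc k) t)) sums prob (\<Union>k. \<Union>t. A (Suc k) t)"
    by (intro finite_measure_UNION) (auto simp: disjoint_family_on_def A_def)
  then have "(\<lambda>k. fin_part (Suc k) + tail_part (Suc k)) sums hit_probability \<Omega> P \<alpha>\<^sub>i \<sigma>2 \<beta> \<Phi>\<^sub>i g I\<^sub>o"
    by (simp add: B hit_probability_def hit)
  \<comment> \<open>From \<open>k = M - 1\<close> on \<open>fin_part (Suc k)\<close> is an empty
    sum, so it can be subtracted from the convergent series and leaves the tails.\<close>
  moreover have "(\<lambda>k. fin_part (Suc k)) sums (\<Sum>k\<in>{..<M - 1}. fin_part (Suc k))"
    by (rule sums_finite) (auto simp: fin_part_def)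
  ultimately have "(\<lambda>k. fin_part (Suc k) + tail_part (Suc k) - fin_part (Suc k)) sums
      (hit_probability \<Omega> P \<alpha>\<^sub>i \<sigma>2 \<beta> \<Phi>\<^sub>i g I\<^sub>o - (\<Sum>k\<in>{..<M - 1}. fin_part (Suc k)))"
    by (rule sums_diff)
  then have "(\<lambda>k. tail_part (Suc k)) sums
      (hit_probability \<Omega> P \<alpha>\<^sub>i \<sigma>2 \<beta> \<Phi>\<^sub>i g I\<^sub>o - (\<Sum>k\<in>{..<M - 1}. fin_part (Suc k)))"
    by simp
  \<comment> \<open>Nonnegative terms turn the ordered series into the unordered sum of the
    claim.\<close>
  moreover have "0 \<le> tail_part (Suc k)" for k
  proof -
    \<comment> \<open>The choice \<open>t = M\<close> saturates the minimum, so that the sign of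
      \<open>Q\<close> at \<open>l = M\<close> is available for every \<open>k\<close>.\<close>
    have "?Q (min M (Suc k + M)) (Suc k) = ?Q M (Suc k)" by simp
    then have "0 \<le> ?Q M (Suc k)" using Q_nonneg[of "Suc k" M] by simp
    moreover have "0 \<le> ?\<mu> * p\<^sub>i" "0 \<le> ?\<mu> * (1 - p\<^sub>i)"
      using \<open>lam > 0\<close> \<open>0 \<le> p\<^sub>i\<close> \<open>p\<^sub>i \<le> 1\<close> by simp_all
    moreover have "(\<Sum>t\<in>{..<M - Suc k}. exp (- \<nu>) * \<nu> ^ t / fact t) \<le> 1" if "0 \<le> \<nu>" for \<nu> :: real
      using sum_le_suminf[OF sums_summable[OF poisson_weights_sums[of \<nu>]], of "{..<M - Suc k}"]
        sums_unique[OF poisson_weights_sums[of \<nu>]] that by simp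
    ultimately show ?thesis
      unfolding tail_part_def using \<open>lam > 0\<close> \<open>D > 0\<close> \<open>0 \<le> p\<^sub>i\<close>
      by (intro mult_nonneg_nonneg divide_nonneg_nonneg zero_le_power) auto
  qed
  ultimately have "((\<lambda>k. tail_part (Suc k)) has_sum
      (hit_probability \<Omega> P \<alpha>\<^sub>i \<sigma>2 \<beta> \<Phi>\<^sub>i g I\<^sub>o - (\<Sum>k\<in>{..<M - 1}. fin_part (Suc k)))) UNIV"
    by (rule sums_nonneg_imp_has_sum)
  then have "(tail_part has_sum
      (hit_probability \<Omega> P \<alpha>\<^sub>i \<sigma>2 \<beta> \<Phi>\<^sub>i g I\<^sub>o - (\<Sum>k\<in>{..<M - 1}. fin_part (Suc k)))) (range Suc)"
    by (subst has_sum_reindex) (auto simp: o_def)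
  moreover have "range Suc = {1..}"
    by (auto simp: image_iff) (metis Suc_le_D One_nat_def)
  ultimately have "infsum tail_part {1..} =
      hit_probability \<Omega> P \<alpha>\<^sub>i \<sigma>2 \<beta> \<Phi>\<^sub>i g I\<^sub>o - (\<Sum>k\<in>{..<M - 1}. fin_part (Suc k))"
    by (simp add: infsumI)
  moreover have "(\<Sum>k\<in>{..<M - 1}. fin_part (Suc k)) = (\<Sum>k\<in>{1..M - 1}. fin_part k)"
    by (rule sum.reindex_bij_witness[of _ "\<lambda>k. k - 1" Suc]) auto
  ultimately have "hit_probability \<Omega> P \<alpha>\<^sub>i \<sigma>2 \<beta> \<Phi>\<^sub>i g I\<^sub>o =
      (\<Sum>k\<in>{1..M - 1}. fin_part k) + infsum tail_part {1..}"
    by simp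
  also have "(\<Sum>k\<in>{1..M - 1}. fin_part k) = (\<Sum>k\<in>{1..M - 1}. \<Sum>t\<in>{..<M - k}. ?Q (k + t) k *
      (exp (- (lam * pi * D\<^sup>2)) * (lam * pi * D\<^sup>2) ^ (k + t) * p\<^sub>i ^ k * (1 - p\<^sub>i) ^ t / (fact k * fact t)))"
    by (simp add: fin_part_def count_weight_def)
  also have "infsum tail_part {1..} = (\<Sum>\<^sub>\<infinity>k\<in>{1..}. ?Q M k *
       (exp (- (lam * p\<^sub>i * pi * D\<^sup>2)) * (lam * p\<^sub>i * pi * D\<^sup>2) ^ k / fact k) *
       (1 - (\<Sum>t\<in>{..<M - k}.
               exp (- (lam * (1 - p\<^sub>i) * pi * D\<^sup>2)) * (lam * (1 - p\<^sub>i) * pi * D\<^sup>2) ^ t / fact t)))"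
  proof (rule infsum_cong)
    have "?\<mu> * p\<^sub>i = lam * p\<^sub>i * pi * D\<^sup>2" "?\<mu> * (1 - p\<^sub>i) = lam * (1 - p\<^sub>i) * pi * D\<^sup>2" by simp_all
    then show "tail_part k = ?Q M k *
       (exp (- (lam * p\<^sub>i * pi * D\<^sup>2)) * (lam * p\<^sub>i * pi * D\<^sup>2) ^ k / fact k) *
       (1 - (\<Sum>t\<in>{..<M - k}.
               exp (- (lam * (1 - p\<^sub>i) * pi * D\<^sup>2)) * (lam * (1 - p\<^sub>i) * pi * D\<^sup>2) ^ t / fact t))" for k
      unfolding tail_part_def by (simp only:)
  qed
  finally show ?thesis .
qed

end
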